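(* Let $\Gamma$ be a nonlinear connection on $E=J^1(\mathbb{R},M)$. A $\Gamma$-linear connection $\nabla$ on $E$ is determined by nine local adapted components $$\nabla\Gamma=\left(\bar G_{11}^1,\;G_{i1}^k,\;G_{(1)(j)1}^{(i)(1)},\;\bar L_{1j}^1,\;L_{ij}^k,\;L_{(1)(j)k}^{(i)(1)},\;\bar C_{1(k)}^{1(1)},\;C_{i(k)}^{j(1)},\;C_{(1)(j)(k)}^{(i)(1)(1)}\right),$$ which are uniquely defined by the relations $$\nabla_{\frac{\delta}{\delta t}}\frac{\delta}{\delta t}=\bar G_{11}^1\frac{\delta}{\delta t},\quad \nabla_{\frac{\delta}{\delta t}}\frac{\delta}{\delta x^i}=G_{i1}^k\frac{\delta}{\delta x^k},\quad \nabla_{\frac{\delta}{\delta t}}\frac{\partial}{\partial y_1^i}=G_{(1)(i)1}^{(k)(1)}\frac{\partial}{\partial y_1^k},$$ $$\nabla_{\frac{\delta}{\delta x^j}}\frac{\delta}{\delta t}=\bar L_{1j}^1\frac{\delta}{\delta t},\quad \nabla_{\frac{\delta}{\delta x^j}}\frac{\delta}{\delta x^i}=L_{ij}^k\frac{\delta}{\delta x^k},\quad \nabla_{\frac{\delta}{\delta x^j}}\frac{\partial}{\partial y_1^i}=L_{(1)(i)j}^{(k)(1)}\frac{\partial}{\partial y_1^k},$$ $$\nabla_{\frac{\partial}{\partial y_1^j}}\frac{\delta}{\delta t}=\bar C_{1(j)}^{1(1)}\frac{\delta}{\delta t},\quad \nabla_{\frac{\partial}{\partial y_1^j}}\frac{\delta}{\delta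 x^i}=C_{i(j)}^{k(1)}\frac{\delta}{\delta x^k},\quad \nabla_{\frac{\partial}{\partial y_1^j}}\frac{\partial}{\partial y_1^i}=C_{(1)(i)(j)}^{(k)(1)(1)}\frac{\partial}{\partial y_1^k}.$$
   Context: $M$ is a smooth $n$-dimensional manifold with local coordinates $(x^i)_{i=\overline{1,n}}$, $\mathbb{R}$ is the time manifold with coordinate $t$, and $E=J^1(\mathbb{R},M)\to\mathbb{R}\times M$ is the 1-jet vector bundle, with local coordinates $(t,x^i,y_1^i)$ transforming by $$\tilde t=\tilde t(t),\quad \tilde x^i=\tilde x^i(x^j),\quad \tilde y_1^i=\frac{\partial\tilde x^i}{\partial x^j}\frac{dt}{d\tilde t}\,y_1^j .$$ Latin indices run over $1,\dots,n$ and repeated Latin indices are summed; the index $1$ refers to the single time direction. A nonlinear connection $\Gamma=\left(M_{(1)1}^{(i)},N_{(1)j}^{(i)}\right)$ on $E$ is a family of local functions on the charts of $E$ transforming by $$\tilde M_{(1)1}^{(k)}=M_{(1)1}^{(j)}\left(\frac{dt}{d\tilde t}\right)^2\frac{\partial\tilde x^k}{\partial x^j}-\frac{dt}{d\tilde t}\frac{\partial\tilde y_1^k}{\partial t},\qquad \tilde N_{(1)l}^{(k)}=N_{(1)i}^{(j)}\frac{dt}{d\tilde t}\frac{\partial x^i}{\partial\tilde x^l}\frac{\partial\tilde x^k}{\partial x^j}-\frac{\partial x^i}{\partial\tilde x^l}\frac{\partial\tilde y_1^k}{\partial x^i}.$$ The adapted basis of vector fields is $$\frac{\delta}{\delta t}=\frac{\partial}{\partial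 t}-M_{(1)1}^{(j)}\frac{\partial}{\partial y_1^j},\quad \frac{\delta}{\delta x^i}=\frac{\partial}{\partial x^i}-N_{(1)i}^{(j)}\frac{\partial}{\partial y_1^j},\quad \frac{\partial}{\partial y_1^i}.$$ $h_{\mathbb{R}}$, $h_M$, $v$ denote the projections of $\mathcal{X}(E)$ onto the summands (globally defined, locally spanned respectively by $\frac{\delta}{\delta t}$, by the $\frac{\delta}{\delta x^i}$, by the $\frac{\partial}{\partial y_1^i}$) of the resulting direct sum decomposition of $\mathcal{X}(E)$. A $\Gamma$-linear connection on $E$ is a linear connection $\nabla:\mathcal{X}(E)\times\mathcal{X}(E)\to\mathcal{X}(E)$ with $\nabla h_{\mathbb{R}}=0$, $\nabla h_M=0$, $\nabla v=0$, i.e. $\nabla_X(hY)=h(\nabla_XY)$ for all $X,Y\in\mathcal{X}(E)$ and $h\in\{h_{\mathbb{R}},h_M,v\}$. *)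

theory Defs
  imports "HOL-Analysis.Analysis"
begin

section \<open>Smooth manifolds\<close>

text \<open>Meant for open \<open>S\<close> only: derivatives are taken in the ambient space.\<close>

primrec C_k_on :: "nat \<Rightarrow> 'a::real_normed_vector set \<Rightarrow> ('a \<Rightarrow> 'b::real_normed_vector) \<Rightarrow> bool" where
  "C_k_on 0 S f \<longleftrightarrow> continuous_on S f"
| "C_k_on (Suc k) S f \<longleftrightarrow> (\<forall>x\<in>S. f differentiable (at x)) \<and>
     (\<forall>v. C_k_on k S (\<lambda>x. frechet_derivative f (at x) v))"

definition smooth_on :: "'a::real_normed_vector set \<Rightarrow> ('a \<Rightarrow> 'b::real_normed_vector) \<Rightarrow> bool" where
  "smooth_on S f \<longleftrightarrow> (\<forall>k. C_k_on k S f)"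

type_synonym ('m, 'n) mchart = "'m set \<times> ('m \<Rightarrow> real^'n)"

text \<open>A smooth manifold of dimension \<open>CARD('n)\<close>. The atlas \<open>A\<close> need not be maximal;
  the maximal atlas of a smooth structure is one admissible choice.\<close>

definition smooth_manifold :: "'m topology \<Rightarrow> ('m, 'n::finite) mchart set \<Rightarrow> bool" where
  "smooth_manifold M A \<longleftrightarrow>
     Hausdorff_space M \<and> second_countable M \<and>
     \<Union>(fst ` A) = topspace M \<and>
     (\<forall>(U, \<phi>)\<in>A. openin M U \<and> open (\<phi> ` U) \<and>
        homeomorphic_map (subtopology M U) (top_of_set (\<phi> ` U)) \<phi>) \<and>
     (\<forall>(U, \<phi>)\<in>A. \<forall>(V, \<psi>)\<in>A. smooth_on (\<phi> ` (U \<inter> V)) (\<psi> \<circ> inv_into U \<phi>))"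


section \<open>The 1-jet bundle \<open>J\<^sup>1(\<real>, M)\<close>\<close>

definition smooth_curve_at :: "('m, 'n::finite) mchart set \<Rightarrow> real \<Rightarrow> (real \<Rightarrow> 'm) \<Rightarrow> bool" where
  "smooth_curve_at A t \<gamma> \<longleftrightarrow>
     (\<exists>(U, \<phi>)\<in>A. \<exists>I. open I \<and> t \<in> I \<and> \<gamma> ` I \<subseteq> U \<and> smooth_on I (\<phi> \<circ> \<gamma>))"

type_synonym 'm jet = "(real \<times> (real \<Rightarrow> 'm)) set"

text \<open>Equality of 1-jets: same source, same target, and same velocity in coordinates.\<close>

definition jet_rel :: "('m, 'n::finite) mchart set \<Rightarrow> ((real \<times> (real \<Rightarrow> 'm)) \<times> (real \<times> (real \<Rightarrow> 'm))) set" where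
  "jet_rel A = {((t, \<gamma>), (s, \<eta>)). t = s \<and> smooth_curve_at A t \<gamma> \<and> smooth_curve_at A s \<eta> \<and>
     \<gamma> t = \<eta> s \<and>
     (\<forall>(U, \<phi>)\<in>A. \<gamma> t \<in> U \<longrightarrow>
        vector_derivative (\<phi> \<circ> \<gamma>) (at t) = vector_derivative (\<phi> \<circ> \<eta>) (at s))}"

definition J1 :: "('m, 'n::finite) mchart set \<Rightarrow> 'm jet set" where
  "J1 A = {(t, \<gamma>). smooth_curve_at A t \<gamma>} // jet_rel A"

definition jet_rep :: "'m jet \<Rightarrow> real \<times> (real \<Rightarrow> 'm)" where
  "jet_rep p = (SOME r. r \<in> p)"

definition jet_time :: "'m jet \<Rightarrow> real" where
  "jet_time p = fst (jet_rep p)"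

definition jet_base :: "'m jet \<Rightarrow> 'm" where
  "jet_base p = snd (jet_rep p) (jet_time p)"

text \<open>Smooth local coordinates of the time manifold \<open>\<real>\<close>: these account for the
  reparametrizations of time in the coordinate changes of the bundle.\<close>

type_synonym tchart = "real set \<times> (real \<Rightarrow> real)"

definition time_charts :: "tchart set" where
  "time_charts = {(I, \<tau>). open I \<and> smooth_on I \<tau> \<and> inj_on \<tau> I \<and> (\<forall>t\<in>I. deriv \<tau> t \<noteq> 0)}"

type_synonym ('m, 'n) echart = "tchart \<times> ('m, 'n) mchart"

definition echarts :: "('m, 'n::finite) mchart set \<Rightarrow> ('m, 'n) echart set" where
  "echarts A = time_charts \<times> A"

definition edom :: "('m, 'n::finite) mchart set \<Rightarrow> ('m, 'n) echart \<Rightarrow> 'm jet set" where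
  "edom A c = {p \<in> J1 A. jet_time p \<in> fst (fst c) \<and> jet_base p \<in> fst (snd c)}"

text \<open>The coordinates \<open>(t, x, y)\<close>, with \<open>y = dx/dt\<close> computed with respect to the time
  coordinate of the chart.\<close>

type_synonym 'n coords = "real \<times> (real^'n) \<times> (real^'n)"

definition ecoord :: "('m, 'n::finite) echart \<Rightarrow> 'm jet \<Rightarrow> 'n coords" where
  "ecoord c p =
     (snd (fst c) (jet_time p),
      snd (snd c) (jet_base p),
      vector_derivative (snd (snd c) \<circ> snd (jet_rep p)) (at (jet_time p))
        /\<^sub>R deriv (snd (fst c)) (jet_time p))"

definition einv :: "('m, 'n::finite) mchart set \<Rightarrow> ('m, 'n) echart \<Rightarrow> 'n coords \<Rightarrow> 'm jet" where
  "einv A c = inv_into (edom A c) (ecoord c)"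

definition jet_open :: "('m, 'n::finite) mchart set \<Rightarrow> 'm jet set \<Rightarrow> bool" where
  "jet_open A W \<longleftrightarrow> W \<subseteq> J1 A \<and> (\<forall>c\<in>echarts A. open (ecoord c ` (W \<inter> edom A c)))"

text \<open>Derivative of the coordinate change from \<open>c\<close> to \<open>c'\<close> at \<open>p\<close>.\<close>

definition dtrans ::
  "('m, 'n::finite) mchart set \<Rightarrow> ('m, 'n) echart \<Rightarrow> ('m, 'n) echart \<Rightarrow> 'm jet \<Rightarrow> 'n coords \<Rightarrow> 'n coords" where
  "dtrans A c c' p = frechet_derivative (ecoord c' \<circ> einv A c) (at (ecoord c p))"

definition smooth_local ::
  "('m, 'n::finite) mchart set \<Rightarrow> ('m, 'n) echart \<Rightarrow> ('m jet \<Rightarrow> 'b::real_normed_vector) \<Rightarrow> bool" where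
  "smooth_local A c f \<longleftrightarrow> smooth_on (ecoord c ` edom A c) (f \<circ> einv A c)"

definition smooth_fun :: "('m, 'n::finite) mchart set \<Rightarrow> ('m jet \<Rightarrow> real) \<Rightarrow> bool" where
  "smooth_fun A f \<longleftrightarrow> (\<forall>c\<in>echarts A. smooth_local A c f)"


section \<open>Vector fields on the jet bundle\<close>

text \<open>A vector field is the family of its component functions in the charts \<open>(t, x, y)\<close>,
  transforming by the Jacobians of the coordinate changes. Components are \<open>0\<close> where they
  have no meaning, so that equality of vector fields is equality of functions.\<close>

type_synonym ('m, 'n) vfield = "('m, 'n) echart \<Rightarrow> 'm jet \<Rightarrow> 'n coords"

definition vfields :: "('m, 'n::finite) mchart set \<Rightarrow> ('m, 'n) vfield set" where
  "vfields A = {X.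
     (\<forall>c\<in>echarts A. smooth_local A c (X c)) \<and>
     (\<forall>c\<in>echarts A. \<forall>c'\<in>echarts A. \<forall>p \<in> edom A c \<inter> edom A c'.
        X c' p = dtrans A c c' p (X c p)) \<and>
     (\<forall>c p. \<not> (c \<in> echarts A \<and> p \<in> edom A c) \<longrightarrow> X c p = 0)}"

definition vadd :: "('m, 'n::finite) vfield \<Rightarrow> ('m, 'n) vfield \<Rightarrow> ('m, 'n) vfield" where
  "vadd X Y = (\<lambda>c p. X c p + Y c p)"

definition vscale :: "('m jet \<Rightarrow> real) \<Rightarrow> ('m, 'n::finite) vfield \<Rightarrow> ('m, 'n) vfield" where
  "vscale f X = (\<lambda>c p. f p *\<^sub>R X c p)"

text \<open>The function \<open>X(f)\<close>, computed in the chart \<open>c\<close>.\<close>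

definition vapply ::
  "('m, 'n::finite) mchart set \<Rightarrow> ('m, 'n) vfield \<Rightarrow> ('m jet \<Rightarrow> real) \<Rightarrow> ('m, 'n) echart \<Rightarrow> 'm jet \<Rightarrow> real" where
  "vapply A X f c p = frechet_derivative (f \<circ> einv A c) (at (ecoord c p)) (X c p)"

type_synonym ('m, 'n) conn = "('m, 'n) vfield \<Rightarrow> ('m, 'n) vfield \<Rightarrow> ('m, 'n) vfield"

definition linear_connection :: "('m, 'n::finite) mchart set \<Rightarrow> ('m, 'n) conn \<Rightarrow> bool" where
  "linear_connection A D \<longleftrightarrow>
     (\<forall>X\<in>vfields A. \<forall>Y\<in>vfields A. D X Y \<in> vfields A) \<and>
     (\<forall>X\<in>vfields A. \<forall>X'\<in>vfields A. \<forall>Y\<in>vfields A. D (vadd X X') Y = vadd (D X Y) (D X' Y)) \<and>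
     (\<forall>f X Y. smooth_fun A f \<longrightarrow> X \<in> vfields A \<longrightarrow> Y \<in> vfields A \<longrightarrow>
        D (vscale f X) Y = vscale f (D X Y)) \<and>
     (\<forall>X\<in>vfields A. \<forall>Y\<in>vfields A. \<forall>Y'\<in>vfields A. D X (vadd Y Y') = vadd (D X Y) (D X Y')) \<and>
     (\<forall>f X Y. smooth_fun A f \<longrightarrow> X \<in> vfields A \<longrightarrow> Y \<in> vfields A \<longrightarrow>
        D X (vscale f Y) = (\<lambda>c p. vapply A X f c p *\<^sub>R Y c p + f p *\<^sub>R D X Y c p))"


section \<open>Nonlinear connections and their adapted bases\<close>

definition ddt :: "'n::finite coords" where
  "ddt = (1, 0, 0)"

definition ddx :: "'n::finite \<Rightarrow> 'n coords" where
  "ddx i = (0, axis i 1, 0)"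

definition ddy :: "'n::finite \<Rightarrow> 'n coords" where
  "ddy i = (0, 0, axis i 1)"

text \<open>A pair \<open>(M, N)\<close> of families indexed by the charts;
  \<open>N c p $ j $ i\<close> is the component with upper index \<open>j\<close> and lower index \<open>i\<close>.\<close>

type_synonym ('m, 'n) nlconn =
  "(('m, 'n) echart \<Rightarrow> 'm jet \<Rightarrow> real^'n) \<times> (('m, 'n) echart \<Rightarrow> 'm jet \<Rightarrow> real^'n^'n)"

definition nonlinear_connection :: "('m, 'n::finite) mchart set \<Rightarrow> ('m, 'n) nlconn \<Rightarrow> bool" where
  "nonlinear_connection A \<Gamma> \<longleftrightarrow>
     (\<forall>c\<in>echarts A. smooth_local A c (fst \<Gamma> c) \<and> smooth_local A c (snd \<Gamma> c)) \<and>
     (\<forall>c\<in>echarts A. \<forall>c'\<in>echarts A. \<forall>p \<in> edom A c \<inter> edom A c'.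
        let dt_dt' = fst (dtrans A c' c p ddt);
            dx_dx' = (\<lambda>i l. fst (snd (dtrans A c' c p (ddx l))) $ i);
            dx'_dx = (\<lambda>k j. fst (snd (dtrans A c c' p (ddx j))) $ k);
            dy'_dt = (\<lambda>k. snd (snd (dtrans A c c' p ddt)) $ k);
            dy'_dx = (\<lambda>k i. snd (snd (dtrans A c c' p (ddx i))) $ k)
        in (\<forall>k. fst \<Gamma> c' p $ k =
              (\<Sum>j\<in>UNIV. fst \<Gamma> c p $ j * dt_dt'\<^sup>2 * dx'_dx k j) - dt_dt' * dy'_dt k) \<and>
           (\<forall>k l. snd \<Gamma> c' p $ k $ l =
              (\<Sum>i\<in>UNIV. \<Sum>j\<in>UNIV. snd \<Gamma> c p $ j $ i * dt_dt' * dx_dx' i l * dx'_dx k j)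
              - (\<Sum>i\<in>UNIV. dx_dx' i l * dy'_dx k i)))"

text \<open>The adapted basis, as local vector fields given by their components in the chart \<open>c\<close>.\<close>

definition \<delta>t :: "('m, 'n::finite) nlconn \<Rightarrow> ('m, 'n) echart \<Rightarrow> 'm jet \<Rightarrow> 'n coords" where
  "\<delta>t \<Gamma> c p = ddt - (\<Sum>j\<in>UNIV. (fst \<Gamma> c p $ j) *\<^sub>R ddy j)"

definition \<delta>x :: "('m, 'n::finite) nlconn \<Rightarrow> ('m, 'n) echart \<Rightarrow> 'n \<Rightarrow> 'm jet \<Rightarrow> 'n coords" where
  "\<delta>x \<Gamma> c i p = ddx i - (\<Sum>j\<in>UNIV. (snd \<Gamma> c p $ j $ i) *\<^sub>R ddy j)"

definition dely :: "'n::finite \<Rightarrow> 'm jet \<Rightarrow> 'n coords" where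
  "dely i p = ddy i"

text \<open>Projection onto \<open>span S\<close> along \<open>span T\<close>, for complementary \<open>span S\<close> and \<open>span T\<close>.\<close>

definition proj_along :: "'a::real_vector set \<Rightarrow> 'a set \<Rightarrow> 'a \<Rightarrow> 'a" where
  "proj_along S T v = (THE a. a \<in> span S \<and> v - a \<in> span T)"

definition h\<^sub>R :: "('m, 'n::finite) nlconn \<Rightarrow> ('m, 'n) vfield \<Rightarrow> ('m, 'n) vfield" where
  "h\<^sub>R \<Gamma> X = (\<lambda>c p. proj_along {\<delta>t \<Gamma> c p}
     (range (\<lambda>i. \<delta>x \<Gamma> c i p) \<union> range (\<lambda>i. dely i p)) (X c p))"

definition h\<^sub>M :: "('m, 'n::finite) nlconn \<Rightarrow> ('m, 'n) vfield \<Rightarrow> ('m, 'n) vfield" where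
  "h\<^sub>M \<Gamma> X = (\<lambda>c p. proj_along (range (\<lambda>i. \<delta>x \<Gamma> c i p))
     ({\<delta>t \<Gamma> c p} \<union> range (\<lambda>i. dely i p)) (X c p))"

definition vproj :: "('m, 'n::finite) nlconn \<Rightarrow> ('m, 'n) vfield \<Rightarrow> ('m, 'n) vfield" where
  "vproj \<Gamma> X = (\<lambda>c p. proj_along (range (\<lambda>i. dely i p))
     ({\<delta>t \<Gamma> c p} \<union> range (\<lambda>i. \<delta>x \<Gamma> c i p)) (X c p))"

definition \<Gamma>_linear_connection ::
  "('m, 'n::finite) mchart set \<Rightarrow> ('m, 'n) nlconn \<Rightarrow> ('m, 'n) conn \<Rightarrow> bool" where
  "\<Gamma>_linear_connection A \<Gamma> D \<longleftrightarrow> linear_connection A D \<and>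
     (\<forall>h\<in>{h\<^sub>R \<Gamma>, h\<^sub>M \<Gamma>, vproj \<Gamma>}. \<forall>X\<in>vfields A. \<forall>Y\<in>vfields A. D X (h Y) = h (D X Y))"


section \<open>Local adapted components\<close>

definition agree_near ::
  "('m, 'n::finite) mchart set \<Rightarrow> ('m, 'n) echart \<Rightarrow> 'm jet \<Rightarrow> ('m, 'n) vfield \<Rightarrow> ('m jet \<Rightarrow> 'n coords) \<Rightarrow> bool" where
  "agree_near A c p X \<xi> \<longleftrightarrow>
     (\<exists>W. jet_open A W \<and> p \<in> W \<and> (\<forall>q \<in> W \<inter> edom A c. X c q = \<xi> q))"

text \<open>The connection induced by \<open>D\<close> on local vector fields over the domain of the chart \<open>c\<close>:
  its value at \<open>p\<close> is the common value of \<open>D X Y\<close> at \<open>p\<close>, for all global \<open>X\<close>, \<open>Y\<close>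
  coinciding near \<open>p\<close> with \<open>\<xi>\<close>, \<open>\<eta>\<close>.\<close>

definition local_conn ::
  "('m, 'n::finite) mchart set \<Rightarrow> ('m, 'n) conn \<Rightarrow> ('m, 'n) echart \<Rightarrow>
   ('m jet \<Rightarrow> 'n coords) \<Rightarrow> ('m jet \<Rightarrow> 'n coords) \<Rightarrow> 'm jet \<Rightarrow> 'n coords" where
  "local_conn A D c \<xi> \<eta> p =
     (THE z. \<forall>X\<in>vfields A. \<forall>Y\<in>vfields A.
        agree_near A c p X \<xi> \<longrightarrow> agree_near A c p Y \<eta> \<longrightarrow> D X Y c p = z)"

text \<open>Upper index first, then the index of the differentiated field, then the index of the
  direction: \<open>L K k i j\<close> is \<open>L\<^sup>k\<^sub>i\<^sub>j\<close>. The suffix \<open>b\<close> is the bar, and \<open>v\<close> marks the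
  components acting on the vertical fields. The time index is omitted.\<close>

datatype ('m, 'n) components = Components
  (Gb: "'m jet \<Rightarrow> real")
  (G: "'n \<Rightarrow> 'n \<Rightarrow> 'm jet \<Rightarrow> real")
  (Gv: "'n \<Rightarrow> 'n \<Rightarrow> 'm jet \<Rightarrow> real")
  (Lb: "'n \<Rightarrow> 'm jet \<Rightarrow> real")
  (L: "'n \<Rightarrow> 'n \<Rightarrow> 'n \<Rightarrow> 'm jet \<Rightarrow> real")
  (Lv: "'n \<Rightarrow> 'n \<Rightarrow> 'n \<Rightarrow> 'm jet \<Rightarrow> real")
  (Cb: "'n \<Rightarrow> 'm jet \<Rightarrow> real")
  (C: "'n \<Rightarrow> 'n \<Rightarrow> 'n \<Rightarrow> 'm jet \<Rightarrow> real")
  (Cv: "'n \<Rightarrow> 'n \<Rightarrow> 'n \<Rightarrow> 'm jet \<Rightarrow> real")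

definition all_components :: "(('m jet \<Rightarrow> real) \<Rightarrow> bool) \<Rightarrow> ('m, 'n::finite) components \<Rightarrow> bool" where
  "all_components P K \<longleftrightarrow>
     P (Gb K) \<and> (\<forall>k i. P (G K k i)) \<and> (\<forall>k i. P (Gv K k i)) \<and>
     (\<forall>j. P (Lb K j)) \<and> (\<forall>k i j. P (L K k i j)) \<and> (\<forall>k i j. P (Lv K k i j)) \<and>
     (\<forall>j. P (Cb K j)) \<and> (\<forall>k i j. P (C K k i j)) \<and> (\<forall>k i j. P (Cv K k i j))"

definition smooth_components ::
  "('m, 'n::finite) mchart set \<Rightarrow> ('m, 'n) echart \<Rightarrow> ('m, 'n) components \<Rightarrow> bool" where
  "smooth_components A c K \<longleftrightarrow> all_components (smooth_local A c) K"

text \<open>The first clause makes functions on the chart domain equal as total functions.\<close>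

definition adapted_components ::
  "('m, 'n::finite) mchart set \<Rightarrow> ('m, 'n) nlconn \<Rightarrow> ('m, 'n) conn \<Rightarrow> ('m, 'n) echart \<Rightarrow>
   ('m, 'n) components \<Rightarrow> bool" where
  "adapted_components A \<Gamma> D c K \<longleftrightarrow>
     all_components (\<lambda>f. \<forall>p. p \<notin> edom A c \<longrightarrow> f p = 0) K \<and>
     (\<forall>p\<in>edom A c.
        local_conn A D c (\<delta>t \<Gamma> c) (\<delta>t \<Gamma> c) p = Gb K p *\<^sub>R \<delta>t \<Gamma> c p \<and>
        (\<forall>i. local_conn A D c (\<delta>t \<Gamma> c) (\<delta>x \<Gamma> c i) p = (\<Sum>k\<in>UNIV. G K k i p *\<^sub>R \<delta>x \<Gamma> c k p)) \<and>
        (\<forall>i. local_conn A D c (\<delta>t \<Gamma> c) (dely i) p = (\<Sum>k\<in>UNIV. Gv K k i p *\<^sub>R dely k p)) \<and>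
        (\<forall>j. local_conn A D c (\<delta>x \<Gamma> c j) (\<delta>t \<Gamma> c) p = Lb K j p *\<^sub>R \<delta>t \<Gamma> c p) \<and>
        (\<forall>i j. local_conn A D c (\<delta>x \<Gamma> c j) (\<delta>x \<Gamma> c i) p = (\<Sum>k\<in>UNIV. L K k i j p *\<^sub>R \<delta>x \<Gamma> c k p)) \<and>
        (\<forall>i j. local_conn A D c (\<delta>x \<Gamma> c j) (dely i) p = (\<Sum>k\<in>UNIV. Lv K k i j p *\<^sub>R dely k p)) \<and>
        (\<forall>j. local_conn A D c (dely j) (\<delta>t \<Gamma> c) p = Cb K j p *\<^sub>R \<delta>t \<Gamma> c p) \<and>
        (\<forall>i j. local_conn A D c (dely j) (\<delta>x \<Gamma> c i) p = (\<Sum>k\<in>UNIV. C K k i j p *\<^sub>R \<delta>x \<Gamma> c k p)) \<and>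
        (\<forall>i j. local_conn A D c (dely j) (dely i) p = (\<Sum>k\<in>UNIV. Cv K k i j p *\<^sub>R dely k p)))"

end

theory Submission
  imports Defs
begin

text \<open>
  Why the components exist. Differentiating a field of one part of the adapted frame gives a field of
  the same part, because \<open>\<nabla>\<close> commutes with the three projections; expanding the result in the frame
  defines the nine families of functions, and linear independence of the frame makes them unique.
  Two points need work before this argument applies.

  The frame is defined only over a chart, whereas \<open>\<nabla>\<close> acts on global fields. Local fields are
  therefore multiplied by a cutoff function and extended by zero (\<open>vextend_in_vfields\<close>). The extension
  is smooth because a compact part of a chart is closed in the bundle, the base being
  Hausdorff (\<open>away_from_compact\<close>). By the usual cutoff argument the value of \<open>\<nabla>\<^sub>X Y\<close> at a
  point depends only on \<open>X\<close> and \<open>Y\<close> near it (\<open>connection_local\<close>). Thus \<open>\<nabla>\<close> acts on local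
  fields, and it maps smooth local fields to smooth local fields (\<open>smooth_local_conn\<close>), which also gives
  smoothness of the components.

  The projections are defined chart by chart, and the compatibility condition is useful only when the
  projection of a smooth global field is again one. For this the three parts of the frame must be mapped
  to the corresponding parts by a coordinate change. This is exactly what the transformation law
  of a nonlinear connection says, once the Jacobian of a coordinate change is known to be block triangular
  with related diagonal blocks (\<open>dtrans_blocks\<close>, \<open>dtrans_frame\<close>, \<open>block_proj_in_vfields\<close>).

  Why the components determine \<open>\<nabla>\<close>. The difference of two connections is linear over the smooth
  functions in both arguments. Hence it vanishes as soon as it vanishes on fields that
  extend the frame (\<open>tensorial_eq_0\<close>, \<open>connection_eqI\<close>), which is what equality of the components says.
\<close>


section \<open>Calculus of smooth maps\<close>

lemma smooth_onD: "smooth_on S f \<Longrightarrow> C_k_on k S f"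
  by (simp add: smooth_on_def)

lemma C_k_on_mono: "C_k_on k S f \<Longrightarrow> T \<subseteq> S \<Longrightarrow> C_k_on k T f"
  by (induction k arbitrary: f) (auto intro: continuous_on_subset)

lemma smooth_on_mono: "smooth_on S f \<Longrightarrow> T \<subseteq> S \<Longrightarrow> smooth_on T f"
  by (auto simp: smooth_on_def intro: C_k_on_mono)

lemma C_k_on_local:
  assumes "\<And>x. x \<in> S \<Longrightarrow> \<exists>T. open T \<and> x \<in> T \<and> C_k_on k T f"
  shows "C_k_on k S f"
  using assms
proof (induction k arbitrary: f)
  case 0
  then have "isCont f x" if "x \<in> S" for x
    using that continuous_on_eq_continuous_at by (metis C_k_on.simps(1))
  then show ?case by (simp add: continuous_at_imp_continuous_on)
next
  case (Suc k)
  have "f differentiable (at x)" if "x \<in> S" for x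
    using Suc.prems[OF that] by auto
  moreover have "C_k_on k S (\<lambda>x. frechet_derivative f (at x) v)" for v
    by (rule Suc.IH) (use Suc.prems in fastforce)
  ultimately show ?case by simp
qed

lemma smooth_on_local:
  assumes "\<And>x. x \<in> S \<Longrightarrow> \<exists>T. open T \<and> x \<in> T \<and> smooth_on T f"
  shows "smooth_on S f"
  unfolding smooth_on_def
  by (intro allI C_k_on_local) (use assms in \<open>auto simp: smooth_on_def; blast\<close>)

lemma C_k_on_cong:
  assumes "open S" "\<And>x. x \<in> S \<Longrightarrow> f x = g x" "C_k_on k S f"
  shows "C_k_on k S g"
  using assms(2,3)
proof (induction k arbitrary: f g)
  case 0
  then show ?case by (auto cong: continuous_on_cong_simp)
next
  case (Suc k)
  have D: "(g has_derivative frechet_derivative f (at x)) (at x)" if "x \<in> S" for x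
    by (rule has_derivative_transform_within_open[of f _ x UNIV S])
      (use Suc.prems that assms(1) in \<open>auto simp: frechet_derivative_works\<close>)
  have "C_k_on k S (\<lambda>x. frechet_derivative g (at x) v)" for v
    by (rule Suc.IH[of "\<lambda>x. frechet_derivative f (at x) v"])
      (use Suc.prems D frechet_derivative_at in \<open>force+\<close>)
  then show ?case using D by (auto simp: differentiable_def)
qed

lemma smooth_on_cong:
  assumes "open S" "smooth_on S f" "\<And>x. x \<in> S \<Longrightarrow> f x = g x"
  shows "smooth_on S g"
  using assms C_k_on_cong unfolding smooth_on_def by blast

lemma C_k_on_SucI:
  assumes "open S" "\<And>x. x \<in> S \<Longrightarrow> (f has_derivative f' x) (at x)"
    and "\<And>v. C_k_on k S (\<lambda>x. f' x v)"
  shows "C_k_on (Suc k) S f"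
proof -
  have "C_k_on k S (\<lambda>x. frechet_derivative f (at x) v)" for v
    by (rule C_k_on_cong[OF assms(1) _ assms(3)[of v]])
      (use assms(2) frechet_derivative_at in metis)
  then show ?thesis using assms(2) by (auto simp: differentiable_def)
qed

lemma C_k_on_SucD:
  assumes "C_k_on (Suc k) S f" "x \<in> S"
  shows "(f has_derivative frechet_derivative f (at x)) (at x)"
  using assms by (auto simp: frechet_derivative_works)

lemma smooth_on_has_derivative:
  assumes "smooth_on S f" "x \<in> S"
  shows "(f has_derivative frechet_derivative f (at x)) (at x)"
  using C_k_on_SucD smooth_onD assms by blast

lemma C_k_on_Suc_imp: "C_k_on (Suc k) S f \<Longrightarrow> C_k_on k S f"
proof (induction k arbitrary: f)
  case 0
  then show ?case
    by (auto intro!: continuous_at_imp_continuous_on differentiable_imp_continuous_within)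
next
  case (Suc k)
  then show ?case by (metis C_k_on.simps(2))
qed

lemma smooth_on_imp_continuous_on: "smooth_on S f \<Longrightarrow> continuous_on S f"
  using smooth_onD[of S f 0] by simp

lemma smooth_on_frechet_derivative:
  "smooth_on S f \<Longrightarrow> smooth_on S (\<lambda>x. frechet_derivative f (at x) v)"
  unfolding smooth_on_def by (metis C_k_on.simps(2))

lemma C_k_on_const: "C_k_on k S (\<lambda>x. c)"
  by (induction k arbitrary: c) auto

lemma smooth_on_const [simp]: "smooth_on S (\<lambda>x. c)"
  by (simp add: smooth_on_def C_k_on_const)

lemma C_k_on_linear:
  assumes "bounded_linear f" shows "C_k_on k S f"
proof (cases k)
  case 0
  then show ?thesis using assms by (simp add: linear_continuous_on)
next
  case (Suc j)
  have "frechet_derivative f (at x) = f" for x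
    using assms bounded_linear_imp_has_derivative frechet_derivative_at by metis
  then show ?thesis
    using assms Suc by (auto simp: C_k_on_const differentiable_def dest: bounded_linear_imp_has_derivative)
qed

lemma smooth_on_linear: "bounded_linear f \<Longrightarrow> smooth_on S f"
  by (simp add: smooth_on_def C_k_on_linear)

lemma C_k_on_add:
  assumes "open S" "C_k_on k S f" "C_k_on k S g"
  shows "C_k_on k S (\<lambda>x. f x + g x)"
  using assms(2,3)
proof (induction k arbitrary: f g)
  case 0
  then show ?case by (auto intro: continuous_intros)
next
  case (Suc k)
  show ?case
  proof (rule C_k_on_SucI[OF assms(1)])
    show "((\<lambda>x. f x + g x) has_derivative
        (\<lambda>v. frechet_derivative f (at x) v + frechet_derivative g (at x) v)) (at x)"
      if "x \<in> S" for x
      by (intro has_derivative_add C_k_on_SucD[OF Suc.prems(1) that] C_k_on_SucD[OF Suc.prems(2) that])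
  qed (use Suc in simp)
qed

lemma C_k_on_bilinear:
  assumes "open S" "bounded_bilinear h" "C_k_on k S f" "C_k_on k S g"
  shows "C_k_on k S (\<lambda>x. h (f x) (g x))"
  using assms(3,4)
proof (induction k arbitrary: f g)
  case 0
  then show ?case
    using bounded_bilinear.continuous_on[OF assms(2)] by auto
next
  case (Suc k)
  show ?case
  proof (rule C_k_on_SucI[OF assms(1)])
    show "((\<lambda>x. h (f x) (g x)) has_derivative
        (\<lambda>v. h (f x) (frechet_derivative g (at x) v) + h (frechet_derivative f (at x) v) (g x))) (at x)"
      if "x \<in> S" for x
      by (intro bounded_bilinear.FDERIV[OF assms(2)]
          C_k_on_SucD[OF Suc.prems(1) that] C_k_on_SucD[OF Suc.prems(2) that])
    have "C_k_on k S f" "C_k_on k S g"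
      using Suc.prems C_k_on_Suc_imp by blast+
    then show "C_k_on k S (\<lambda>x. h (f x) (frechet_derivative g (at x) v) +
        h (frechet_derivative f (at x) v) (g x))" for v
      by (intro C_k_on_add[OF assms(1)] Suc.IH) (use Suc.prems in simp_all)
  qed
qed

lemma C_k_on_linear_comp:
  assumes "open S" "bounded_linear l" "C_k_on k S f"
  shows "C_k_on k S (\<lambda>x. l (f x))"
  using assms(3)
proof (induction k arbitrary: f)
  case 0
  then show ?case by (auto intro: bounded_linear.continuous_on[OF assms(2)])
next
  case (Suc k)
  show ?case
  proof (rule C_k_on_SucI[OF assms(1)])
    show "((\<lambda>x. l (f x)) has_derivative (\<lambda>v. l (frechet_derivative f (at x) v))) (at x)"
      if "x \<in> S" for x
      by (intro bounded_linear.has_derivative[OF assms(2)] C_k_on_SucD[OF Suc.prems that])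
  qed (use Suc in simp)
qed

lemma C_k_on_sum:
  assumes "open S" "\<And>i. i \<in> I \<Longrightarrow> C_k_on k S (f i)"
  shows "C_k_on k S (\<lambda>x. \<Sum>i\<in>I. f i x)"
  using assms(2)
  by (induction I rule: infinite_finite_induct)
    (auto intro: C_k_on_const C_k_on_add[OF assms(1)])

lemma linear_sum_Basis:
  fixes f :: "'a::euclidean_space \<Rightarrow> 'b::real_vector"
  assumes "linear f"
  shows "f w = (\<Sum>b\<in>Basis. (w \<bullet> b) *\<^sub>R f b)"
proof -
  have "f w = f (\<Sum>b\<in>Basis. (w \<bullet> b) *\<^sub>R b)" by (simp add: euclidean_representation)
  also have "\<dots> = (\<Sum>b\<in>Basis. (w \<bullet> b) *\<^sub>R f b)"
    by (simp add: linear_sum[OF assms] linear_scale[OF assms])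
  finally show ?thesis .
qed

text \<open>The chain rule gives \<open>f'(g x) (g' x v)\<close>, where the direction depends on \<open>x\<close>. Expanding the
  direction in a basis turns this into a sum of products of functions to which the induction
  hypothesis applies; this is why the intermediate space is Euclidean.\<close>

lemma C_k_on_compose:
  fixes g :: "'a::real_normed_vector \<Rightarrow> 'b::euclidean_space"
    and f :: "'b \<Rightarrow> 'c::real_normed_vector"
  assumes "open S" "g ` S \<subseteq> T" "C_k_on k T f" "C_k_on k S g"
  shows "C_k_on k S (\<lambda>x. f (g x))"
  using assms(3,4)
proof (induction k arbitrary: f)
  case 0
  then show ?case
    by (simp add: continuous_on_compose2[OF _ _ assms(2)])
next
  case (Suc k)
  have D: "((\<lambda>x. f (g x)) has_derivative
      (\<lambda>v. \<Sum>b\<in>Basis. (frechet_derivative g (at x) v \<bullet> b) *\<^sub>R frechet_derivative f (at (g x)) b)) (at x)"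
    if x: "x \<in> S" for x
  proof -
    have f: "(f has_derivative frechet_derivative f (at (g x))) (at (g x))"
      using C_k_on_SucD[OF Suc.prems(1)] assms(2) x by blast
    have lin: "linear (frechet_derivative f (at (g x)))"
      using f has_derivative_linear by blast
    show ?thesis
      by (rule has_derivative_eq_rhs[OF has_derivative_compose[OF C_k_on_SucD[OF Suc.prems(2) x] f]])
        (rule ext, rule linear_sum_Basis[OF lin])
  qed
  show ?case
  proof (rule C_k_on_SucI[OF assms(1) D])
    fix v
    have f': "C_k_on k S (\<lambda>x. frechet_derivative f (at (g x)) b)" for b
      using Suc.prems(1) C_k_on_Suc_imp[OF Suc.prems(2)] by (intro Suc.IH) simp_all
    have g': "C_k_on k S (\<lambda>x. frechet_derivative g (at x) v \<bullet> b)" for b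
      by (rule C_k_on_linear_comp[OF assms(1) bounded_linear_inner_left]) (use Suc.prems in simp)
    show "C_k_on k S (\<lambda>x. \<Sum>b\<in>Basis. (frechet_derivative g (at x) v \<bullet> b) *\<^sub>R
        frechet_derivative f (at (g x)) b)"
      by (intro C_k_on_sum C_k_on_bilinear[OF assms(1) bounded_bilinear_scaleR] assms f' g')
  qed
qed

lemma smooth_on_add:
  "open S \<Longrightarrow> smooth_on S f \<Longrightarrow> smooth_on S g \<Longrightarrow> smooth_on S (\<lambda>x. f x + g x)"
  by (simp add: smooth_on_def C_k_on_add)

lemma smooth_on_bilinear:
  "open S \<Longrightarrow> bounded_bilinear h \<Longrightarrow> smooth_on S f \<Longrightarrow> smooth_on S g \<Longrightarrow>
    smooth_on S (\<lambda>x. h (f x) (g x))"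
  by (simp add: smooth_on_def C_k_on_bilinear)

lemmas smooth_on_scaleR = smooth_on_bilinear[OF _ bounded_bilinear_scaleR]
lemmas smooth_on_mult = smooth_on_bilinear[OF _ bounded_bilinear_mult]
lemmas smooth_on_inner = smooth_on_bilinear[OF _ bounded_bilinear_inner]

lemma smooth_on_linear_comp:
  "open S \<Longrightarrow> bounded_linear l \<Longrightarrow> smooth_on S f \<Longrightarrow> smooth_on S (\<lambda>x. l (f x))"
  by (simp add: smooth_on_def C_k_on_linear_comp)

lemma smooth_on_sum:
  "open S \<Longrightarrow> (\<And>i. i \<in> I \<Longrightarrow> smooth_on S (f i)) \<Longrightarrow> smooth_on S (\<lambda>x. \<Sum>i\<in>I. f i x)"
  by (simp add: smooth_on_def C_k_on_sum)

lemma smooth_on_diff: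
  assumes "open S" "smooth_on S f" "smooth_on S g"
  shows "smooth_on S (\<lambda>x. f x - g x)"
  using smooth_on_add[OF assms(1,2) smooth_on_linear_comp[OF assms(1) _ assms(3), of uminus]]
  by (simp add: bounded_linear_minus bounded_linear_ident)

lemma smooth_on_compose:
  fixes g :: "'a::real_normed_vector \<Rightarrow> 'b::euclidean_space"
  assumes "open S" "smooth_on T f" "smooth_on S g" "g ` S \<subseteq> T"
  shows "smooth_on S (\<lambda>x. f (g x))"
  using assms by (auto simp: smooth_on_def intro: C_k_on_compose)

lemma smooth_on_Pair:
  assumes "open S" "smooth_on S f" "smooth_on S g"
  shows "smooth_on S (\<lambda>x. (f x, g x))"
  using smooth_on_add[OF assms(1)
      smooth_on_linear_comp[OF assms(1) _ assms(2), of "\<lambda>a. (a, 0)"]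
      smooth_on_linear_comp[OF assms(1) _ assms(3), of "\<lambda>b. (0, b)"]]
  by (simp add: bounded_linear_Pair bounded_linear_ident bounded_linear_zero)

lemma smooth_on_frechet_derivative_compose:
  fixes g :: "'a::real_normed_vector \<Rightarrow> 'b::euclidean_space"
  assumes "open S" "smooth_on T f" "smooth_on S g" "g ` S \<subseteq> T" "smooth_on S h"
  shows "smooth_on S (\<lambda>x. frechet_derivative f (at (g x)) (h x))"
proof (rule smooth_on_cong[OF assms(1)])
  show "smooth_on S (\<lambda>x. \<Sum>b\<in>Basis. (h x \<bullet> b) *\<^sub>R frechet_derivative f (at (g x)) b)"
    by (intro smooth_on_sum smooth_on_scaleR smooth_on_inner smooth_on_const assms
        smooth_on_compose[OF _ smooth_on_frechet_derivative[OF assms(2)] assms(3)])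
  show "(\<Sum>b\<in>Basis. (h x \<bullet> b) *\<^sub>R frechet_derivative f (at (g x)) b) =
      frechet_derivative f (at (g x)) (h x)" if "x \<in> S" for x
    by (rule linear_sum_Basis[symmetric], rule has_derivative_linear,
        rule smooth_on_has_derivative[OF assms(2)]) (use that assms(4) in blast)
qed

lemma smooth_on_inverse:
  fixes f :: "'a::real_normed_vector \<Rightarrow> real"
  assumes S: "open S" and f: "smooth_on S f" and nz: "\<And>x. x \<in> S \<Longrightarrow> f x \<noteq> 0"
  shows "smooth_on S (\<lambda>x. inverse (f x))"
proof -
  have "C_k_on k {x. x \<noteq> (0::real)} inverse" for k
  proof (induction k)
    case 0
    then show ?case by (auto intro!: continuous_intros)
  next
    case (Suc k)
    show ?case
    proof (rule C_k_on_SucI)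
      show "open {x::real. x \<noteq> 0}" using open_Compl[of "{0::real}"] by (simp add: Compl_eq)
      then show "C_k_on k {x. x \<noteq> 0} (\<lambda>x. - (inverse x * v * inverse x))" for v :: real
        by (intro C_k_on_linear_comp[of _ uminus] C_k_on_bilinear[OF _ bounded_bilinear_mult]
             C_k_on_const Suc bounded_linear_minus bounded_linear_ident)
      show "(inverse has_derivative (\<lambda>v. - (inverse x * v * inverse x))) (at x)"
        if "x \<in> {x. x \<noteq> 0}" for x :: real
        using that by (intro has_derivative_inverse') auto
    qed
  qed
  then have "smooth_on {x. x \<noteq> (0::real)} inverse" by (simp add: smooth_on_def)
  then show ?thesis by (rule smooth_on_compose[OF S _ f]) (use nz in auto)
qed

text \<open>The derivative of the inverse function is \<open>1 / f'\<close> evaluated along the inverse function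
  itself, so each order of differentiability of the inverse yields the next one.\<close>

lemma smooth_on_inv_into_real:
  fixes f :: "real \<Rightarrow> real"
  assumes I: "open I" and f: "smooth_on I f" and inj: "inj_on f I"
    and nz: "\<And>t. t \<in> I \<Longrightarrow> deriv f t \<noteq> 0"
  shows "open (f ` I)" "smooth_on (f ` I) (inv_into I f)"
proof -
  have cf: "continuous_on I f" by (rule smooth_on_imp_continuous_on[OF f])
  show op: "open (f ` I)" by (rule invariance_of_domain[OF cf I inj])
  have fd: "(f has_field_derivative deriv f t) (at t)" if "t \<in> I" for t
    using smooth_on_has_derivative[OF f that]
    by (metis DERIV_deriv_iff_real_differentiable differentiable_def)
  have fd': "frechet_derivative f (at t) 1 = deriv f t" if "t \<in> I" for t
    using frechet_derivative_at[OF fd[OF that, unfolded has_field_derivative_def]]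
    by (metis mult.right_neutral)
  have d: "(inv_into I f has_derivative
      (\<lambda>v. inverse (frechet_derivative f (at (inv_into I f s)) 1) *\<^sub>R v)) (at s)"
    if "s \<in> f ` I" for s
  proof -
    obtain t where t: "t \<in> I" "s = f t" using \<open>s \<in> f ` I\<close> by auto
    have [simp]: "inv_into I f (f t) = t" by (simp add: t inj)
    have "(inv_into I f has_derivative (\<lambda>v. inverse (deriv f t) * v)) (at (f t))"
      by (rule has_derivative_inverse_strong[OF I t(1) cf, where f'="\<lambda>v. deriv f t * v"])
        (use fd[OF t(1)] nz[OF t(1)] inj in \<open>auto simp: has_field_derivative_def fun_eq_iff\<close>)
    then show ?thesis by (simp add: t fd')
  qed
  have "C_k_on k (f ` I) (inv_into I f)" for k
  proof (induction k)
    case 0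
    then show ?case
      using has_derivative_continuous[OF d] by (simp add: continuous_at_imp_continuous_on)
  next
    case (Suc k)
    have sm: "smooth_on I (\<lambda>t. inverse (frechet_derivative f (at t) 1))"
      by (rule smooth_on_inverse[OF I smooth_on_frechet_derivative[OF f]])
        (simp add: fd' nz)
    have "inv_into I f ` f ` I \<subseteq> I" by (auto simp: inv_into_into)
    then show ?case
      by (intro C_k_on_SucI[OF op d] C_k_on_bilinear[OF op bounded_bilinear_scaleR] C_k_on_const
          C_k_on_compose[OF op _ smooth_onD[OF sm] Suc])
  qed
  then show "smooth_on (f ` I) (inv_into I f)" by (simp add: smooth_on_def)
qed

section \<open>Smooth plateau functions\<close>

text \<open>The derivatives of \<open>exp (-1/x)\<close> stay inside the span of the functions
  \<open>x\<^sup>-\<^sup>m exp (-1/x)\<close>, which, extended by zero to \<open>x \<le> 0\<close>, all tend to \<open>0\<close> at the origin.\<close>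

definition flat :: "nat \<Rightarrow> real \<Rightarrow> real" where
  "flat m x = (if x > 0 then inverse x ^ m * exp (- inverse x) else 0)"

lemma flat_tendsto_0: "(flat m \<longlongrightarrow> 0) (at 0)"
proof (rule filterlim_split_at)
  have "((\<lambda>x. inverse x ^ m / exp (inverse x)) \<longlongrightarrow> 0) (at_right (0::real))"
    by (rule filterlim_compose[OF tendsto_power_div_exp_0 filterlim_inverse_at_top_right])
  moreover have "\<forall>\<^sub>F x in at_right 0. inverse x ^ m / exp (inverse x) = flat m x"
    by (rule eventually_mono[OF eventually_at_right_less])
      (simp add: flat_def exp_minus divide_inverse)
  ultimately show "(flat m \<longlongrightarrow> 0) (at_right 0)"
    by (rule Lim_transform_eventually)
  have "\<forall>\<^sub>F x in at_left 0. flat m x = 0"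
    by (simp add: flat_def eventually_at_filter)
  then show "(flat m \<longlongrightarrow> 0) (at_left 0)" by (rule tendsto_eventually)
qed

lemma flat_has_derivative:
  "(flat m has_derivative (\<lambda>v. (flat (m + 2) x - real m * flat (m + 1) x) * v)) (at x)"
proof -
  consider "x > 0" | "x < 0" | "x = 0" by linarith
  then show ?thesis
  proof cases
    case 1
    have "((\<lambda>x. inverse x ^ m * exp (- inverse x)) has_field_derivative
        real m * (inverse x ^ (m - Suc 0) * - (inverse x * inverse x)) * exp (- inverse x)
        + exp (- inverse x) * (inverse x * inverse x) * inverse x ^ m) (at x)"
      using 1 by (auto intro!: derivative_eq_intros)
    moreover have "real m * (inverse x ^ (m - Suc 0) * - (inverse x * inverse x)) * exp (- inverse x)
        + exp (- inverse x) * (inverse x * inverse x) * inverse x ^ m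
        = flat (m + 2) x - real m * flat (m + 1) x"
      using 1 by (cases m) (simp_all add: flat_def algebra_simps power2_eq_square)
    ultimately have "((\<lambda>x. inverse x ^ m * exp (- inverse x)) has_field_derivative
        flat (m + 2) x - real m * flat (m + 1) x) (at x)"
      by simp
    then show ?thesis
      unfolding has_field_derivative_def
      by (rule has_derivative_transform_within_open[of _ _ x UNIV "{0<..}"])
        (use 1 in \<open>auto simp: flat_def\<close>)
  next
    case 2
    have "((\<lambda>x. 0) has_derivative (\<lambda>v. 0)) (at x)" by simp
    then have "(flat m has_derivative (\<lambda>v. 0)) (at x)"
      by (rule has_derivative_transform_within_open[of _ _ x UNIV "{..<0}"])
        (use 2 in \<open>auto simp: flat_def\<close>)
    then show ?thesis using 2 by (simp add: flat_def)
  next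
    case 3
    have "flat m h / h = flat (m + 1) h" for h
      by (auto simp: flat_def field_simps)
    then have "(flat m has_field_derivative 0) (at 0)"
      using flat_tendsto_0[of "m + 1"] by (simp add: DERIV_def flat_def[of _ 0])
    then show ?thesis using 3 by (simp add: has_field_derivative_def flat_def lambda_zero)
  qed
qed

lemma smooth_flat: "smooth_on UNIV (flat m)"
proof -
  have "C_k_on k UNIV (flat m)" for k
  proof (induction k arbitrary: m)
    case 0
    then show ?case
      using has_derivative_continuous[OF flat_has_derivative]
      by (simp add: continuous_at_imp_continuous_on)
  next
    case (Suc k)
    have *: "(\<lambda>x. (flat (m + 2) x - real m * flat (m + 1) x) * v)
      = (\<lambda>x. flat (m + 2) x * v + flat (m + 1) x * (- real m * v))" for v
      by (auto simp: algebra_simps)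
    show ?case
      by (rule C_k_on_SucI[OF open_UNIV flat_has_derivative], unfold *)
        (intro C_k_on_add C_k_on_bilinear[OF _ bounded_bilinear_mult] C_k_on_const Suc open_UNIV)
  qed
  then show ?thesis by (simp add: smooth_on_def)
qed

text \<open>The quotient \<open>e(4 - u) / (e(4 - u) + e(u - 1))\<close> with \<open>e = flat 0\<close>
  is \<open>1\<close> for \<open>u \<le> 1\<close> and \<open>0\<close> for \<open>u \<ge> 4\<close>; it is taken at \<open>u = |z - a|\<^sup>2 / r\<^sup>2\<close>.\<close>

lemma exists_plateau:
  fixes a :: "'a::euclidean_space"
  assumes "r > 0"
  obtains \<beta> :: "'a \<Rightarrow> real" where "smooth_on UNIV \<beta>"
    "\<And>z. z \<in> ball a r \<Longrightarrow> \<beta> z = 1" "\<And>z. z \<notin> cball a (2 * r) \<Longrightarrow> \<beta> z = 0"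
proof
  define u where "u z = ((z - a) \<bullet> (z - a)) / r\<^sup>2" for z
  define \<beta> where "\<beta> z = flat 0 (4 - u z) * inverse (flat 0 (4 - u z) + flat 0 (u z - 1))" for z
  have u: "smooth_on UNIV u"
    unfolding u_def divide_inverse
    by (intro smooth_on_mult smooth_on_inner smooth_on_diff smooth_on_const
        smooth_on_linear bounded_linear_ident open_UNIV)
  have "flat 0 (4 - s) + flat 0 (s - 1) \<noteq> 0" for s
    by (cases "s < 4") (auto simp: flat_def add_pos_pos intro!: less_imp_neq[symmetric])
  then show "smooth_on UNIV \<beta>"
    unfolding \<beta>_def
    by (intro smooth_on_mult smooth_on_inverse smooth_on_add smooth_on_compose[OF _ smooth_flat]
        smooth_on_diff u smooth_on_const open_UNIV) auto
  have u': "u z = (dist a z / r)\<^sup>2" for z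
    by (simp add: u_def dist_commute[of a z] power_divide)
      (simp add: dist_norm power2_norm_eq_inner)
  show "\<beta> z = 1" if "z \<in> ball a r" for z
  proof -
    have "dist a z / r < 1" using that assms by simp
    then have "u z < 1"
      unfolding u' using assms by (simp add: power_less_one_iff abs_square_less_1)
    then show ?thesis by (simp add: \<beta>_def flat_def)
  qed
  show "\<beta> z = 0" if "z \<notin> cball a (2 * r)" for z
  proof -
    have "dist a z / r \<ge> 2" using that assms by (simp add: field_simps)
    then have "u z \<ge> 4" unfolding u' using power_mono[of 2 "dist a z / r" 2] by simp
    then show ?thesis by (simp add: \<beta>_def flat_def)
  qed
qed

section \<open>The jet bundle and its coordinate changes\<close>

definition jet_vel :: "('m \<Rightarrow> real^'n::finite) \<Rightarrow> 'm jet \<Rightarrow> real^'n" where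
  "jet_vel \<phi> p = vector_derivative (\<phi> \<circ> snd (jet_rep p)) (at (jet_time p))"

lemma ecoord_eq:
  "ecoord ((I, \<tau>), (U, \<phi>)) p =
    (\<tau> (jet_time p), \<phi> (jet_base p), jet_vel \<phi> p /\<^sub>R deriv \<tau> (jet_time p))"
  by (simp add: ecoord_def jet_vel_def)

lemma edom_eq:
  "edom A ((I, \<tau>), (U, \<phi>)) = {p \<in> J1 A. jet_time p \<in> I \<and> jet_base p \<in> U}"
  by (simp add: edom_def)

locale jet_space =
  fixes M :: "'m topology" and A :: "('m, 'n::finite) mchart set"
  assumes manifold: "smooth_manifold M A"
begin

lemma chart:
  assumes "(U, \<phi>) \<in> A"
  shows openin_chart: "openin M U" and open_chart_image: "open (\<phi> ` U)"
    and homeo_chart: "homeomorphic_map (subtopology M U) (top_of_set (\<phi> ` U)) \<phi>"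
    and inj_chart: "inj_on \<phi> U"
proof -
  show U: "openin M U" and "open (\<phi> ` U)"
    and h: "homeomorphic_map (subtopology M U) (top_of_set (\<phi> ` U)) \<phi>"
    using manifold assms unfolding smooth_manifold_def by blast+
  show "inj_on \<phi> U"
    using homeomorphic_imp_injective_map[OF h] openin_subset[OF U]
    by (simp add: topspace_subtopology Int_absorb1)
qed

lemma open_image_chart:
  assumes "(U, \<phi>) \<in> A" "openin M W" "W \<subseteq> U"
  shows "open (\<phi> ` W)"
proof -
  have "openin (subtopology M U) W"
    using assms by (metis inf.absorb_iff2 openin_subtopology_Int2 inf_commute)
  then have "openin (top_of_set (\<phi> ` U)) (\<phi> ` W)"
    using homeomorphic_imp_open_map[OF homeo_chart[OF assms(1)]] by (simp add: open_map_def)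
  then show ?thesis using openin_open_trans open_chart_image[OF assms(1)] by blast
qed

lemma smooth_transition:
  "(U, \<phi>) \<in> A \<Longrightarrow> (V, \<psi>) \<in> A \<Longrightarrow> smooth_on (\<phi> ` (U \<inter> V)) (\<psi> \<circ> inv_into U \<phi>)"
  using manifold unfolding smooth_manifold_def by blast

text \<open>Smoothness of a curve is tested in some chart of the atlas only; transition maps carry it to
  every chart around the point.\<close>

lemma curve_in_chart:
  assumes "smooth_curve_at A t \<gamma>" "(V, \<psi>) \<in> A" "\<gamma> t \<in> V"
  obtains I where "open I" "t \<in> I" "\<gamma> ` I \<subseteq> V" "smooth_on I (\<psi> \<circ> \<gamma>)"
proof -
  obtain U \<phi> I where U: "(U, \<phi>) \<in> A" and I: "open I" "t \<in> I" "\<gamma> ` I \<subseteq> U" "smooth_on I (\<phi> \<circ> \<gamma>)"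
    using assms(1) unfolding smooth_curve_at_def by blast
  define J where "J = I \<inter> (\<phi> \<circ> \<gamma>) -` (\<phi> ` (U \<inter> V))"
  have UV: "open (\<phi> ` (U \<inter> V))"
    using open_image_chart[OF U] openin_Int[OF openin_chart[OF U] openin_chart[OF assms(2)]] by simp
  have J: "open J"
    unfolding J_def
    by (rule continuous_open_preimage[OF smooth_on_imp_continuous_on[OF I(4)] I(1) UV])
  have \<gamma>J: "\<gamma> r \<in> U \<inter> V" if "r \<in> J" for r
    using that I(3) inj_chart[OF U] unfolding J_def by (auto dest: inj_onD)
  have "smooth_on J (\<lambda>r. (\<psi> \<circ> inv_into U \<phi>) ((\<phi> \<circ> \<gamma>) r))"
    by (rule smooth_on_compose[OF J smooth_transition[OF U assms(2)] smooth_on_mono[OF I(4)]])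
      (auto simp: J_def)
  then have "smooth_on J (\<psi> \<circ> \<gamma>)"
    by (rule smooth_on_cong[OF J]) (use \<gamma>J inj_chart[OF U] in auto)
  moreover have "t \<in> J" using I assms by (auto simp: J_def)
  ultimately show thesis using that[OF J] \<gamma>J by blast
qed

lemma curve_velocity:
  assumes "smooth_curve_at A t \<gamma>" "(U, \<phi>) \<in> A" "\<gamma> t \<in> U"
  shows "((\<phi> \<circ> \<gamma>) has_vector_derivative vector_derivative (\<phi> \<circ> \<gamma>) (at t)) (at t)"
proof -
  obtain I where "t \<in> I" "smooth_on I (\<phi> \<circ> \<gamma>)" using curve_in_chart[OF assms] by blast
  then have "(\<phi> \<circ> \<gamma>) differentiable (at t)"
    using smooth_on_has_derivative differentiable_def by blast
  then show ?thesis by (simp add: vector_derivative_works)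
qed

lemma velocity_transition:
  assumes "smooth_curve_at A t \<gamma>" "(U, \<phi>) \<in> A" "(V, \<psi>) \<in> A" "\<gamma> t \<in> U" "\<gamma> t \<in> V"
  shows "vector_derivative (\<psi> \<circ> \<gamma>) (at t) =
    frechet_derivative (\<psi> \<circ> inv_into U \<phi>) (at (\<phi> (\<gamma> t))) (vector_derivative (\<phi> \<circ> \<gamma>) (at t))"
proof -
  let ?F = "frechet_derivative (\<psi> \<circ> inv_into U \<phi>) (at (\<phi> (\<gamma> t)))"
  let ?w = "vector_derivative (\<phi> \<circ> \<gamma>) (at t)"
  obtain I where I: "open I" "t \<in> I" "\<gamma> ` I \<subseteq> U"
    using curve_in_chart[OF assms(1,2,4)] by metis
  have F: "((\<psi> \<circ> inv_into U \<phi>) has_derivative ?F) (at ((\<phi> \<circ> \<gamma>) t))"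
    unfolding comp_apply[of \<phi> \<gamma>]
    by (rule smooth_on_has_derivative[OF smooth_transition[OF assms(2,3)]]) (use assms(4,5) in auto)
  have "((\<lambda>r. (\<psi> \<circ> inv_into U \<phi>) ((\<phi> \<circ> \<gamma>) r)) has_derivative (\<lambda>r. ?F (r *\<^sub>R ?w))) (at t)"
    by (rule has_derivative_compose[where f="\<phi> \<circ> \<gamma>" and g="\<psi> \<circ> inv_into U \<phi>" and g'="?F", OF _ F])
      (use curve_velocity[OF assms(1,2,4)] in \<open>simp add: has_vector_derivative_def\<close>)
  then have "((\<psi> \<circ> \<gamma>) has_derivative (\<lambda>r. ?F (r *\<^sub>R ?w))) (at t)"
    by (rule has_derivative_transform_within_open[OF _ I(1,2)])
      (use I(3) inj_chart[OF assms(2)] in auto)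
  then have "((\<psi> \<circ> \<gamma>) has_vector_derivative ?F ?w) (at t)"
    by (simp add: has_vector_derivative_def linear_scale[OF has_derivative_linear[OF F]])
  then show ?thesis by (rule vector_derivative_at)
qed

text \<open>A jet is accessed through a chosen representative, so time, base point and velocity have to be
  shown not to depend on the choice.\<close>

lemma jet_class:
  assumes "smooth_curve_at A t \<gamma>"
  defines "p \<equiv> jet_rel A `` {(t, \<gamma>)}"
  shows "p \<in> J1 A" "jet_time p = t" "jet_base p = \<gamma> t"
    and "(U, \<phi>) \<in> A \<Longrightarrow> \<gamma> t \<in> U \<Longrightarrow> jet_vel \<phi> p = vector_derivative (\<phi> \<circ> \<gamma>) (at t)"
    and "smooth_curve_at A (jet_time p) (snd (jet_rep p))"
proof -
  show "p \<in> J1 A" unfolding J1_def p_def using assms(1) by (auto intro: quotientI)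
  have "(t, \<gamma>) \<in> p" using assms(1) by (auto simp: p_def jet_rel_def)
  then have "jet_rep p \<in> p" unfolding jet_rep_def by (rule someI)
  then have "((t, \<gamma>), jet_rep p) \<in> jet_rel A" by (simp add: p_def)
  then show "jet_time p = t" "jet_base p = \<gamma> t"
    "smooth_curve_at A (jet_time p) (snd (jet_rep p))"
    "(U, \<phi>) \<in> A \<Longrightarrow> \<gamma> t \<in> U \<Longrightarrow> jet_vel \<phi> p = vector_derivative (\<phi> \<circ> \<gamma>) (at t)"
    by (auto simp: jet_rel_def jet_time_def jet_base_def jet_vel_def split: prod.splits)
qed

lemma jet_cases:
  assumes "p \<in> J1 A"
  obtains t \<gamma> where "smooth_curve_at A t \<gamma>" "p = jet_rel A `` {(t, \<gamma>)}"
  using assms unfolding J1_def by (auto elim!: quotientE)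

lemma jet_curve:
  assumes "p \<in> J1 A"
  shows "smooth_curve_at A (jet_time p) (snd (jet_rep p))"
  using jet_cases[OF assms] jet_class(5) by metis

lemma jet_vel_transition:
  assumes "p \<in> J1 A" "(U, \<phi>) \<in> A" "(V, \<psi>) \<in> A" "jet_base p \<in> U" "jet_base p \<in> V"
  shows "jet_vel \<psi> p =
    frechet_derivative (\<psi> \<circ> inv_into U \<phi>) (at (\<phi> (jet_base p))) (jet_vel \<phi> p)"
  using velocity_transition[OF jet_curve[OF assms(1)] assms(2,3)] assms(4,5)
  by (simp add: jet_vel_def jet_base_def)

text \<open>Jets are compared in all charts, but by the transformation rule the velocity in one chart
  determines the velocities in the others.\<close>

lemma jet_eqI:
  assumes "p \<in> J1 A" "q \<in> J1 A" "jet_time p = jet_time q" "jet_base p = jet_base q"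
    and "(U, \<phi>) \<in> A" "jet_base p \<in> U" "jet_vel \<phi> p = jet_vel \<phi> q"
  shows "p = q"
proof -
  obtain t \<gamma> where p: "smooth_curve_at A t \<gamma>" "p = jet_rel A `` {(t, \<gamma>)}"
    using jet_cases[OF assms(1)] .
  obtain s \<eta> where q: "smooth_curve_at A s \<eta>" "q = jet_rel A `` {(s, \<eta>)}"
    using jet_cases[OF assms(2)] .
  note [simp] = jet_class(2,3)[OF p(1), folded p(2)] jet_class(2,3)[OF q(1), folded q(2)]
  have "vector_derivative (\<psi> \<circ> \<gamma>) (at t) = vector_derivative (\<psi> \<circ> \<eta>) (at s)"
    if V: "(V, \<psi>) \<in> A" "\<gamma> t \<in> V" for V \<psi>
    using jet_vel_transition[OF assms(1,5) V(1)] jet_vel_transition[OF assms(2,5) V(1)] assms(3-7) V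
      jet_class(4)[OF p(1) V(1), folded p(2)] jet_class(4)[OF q(1) V(1), folded q(2)]
    by simp
  then have "jet_rel A `` {(t, \<gamma>)} = jet_rel A `` {(s, \<eta>)}"
    using p(1) q(1) assms(3,4) by (auto simp: jet_rel_def)
  then show ?thesis using p q by simp
qed

text \<open>The witness is the curve that is a straight line in the chart. Away from \<open>t\<close> the line may leave the
  image of the chart, where the inverse takes arbitrary values.\<close>

lemma jet_exists:
  assumes "(U, \<phi>) \<in> A" "x \<in> U"
  obtains p where "p \<in> J1 A" "jet_time p = t" "jet_base p = x" "jet_vel \<phi> p = w"
proof -
  define l where "l r = \<phi> x + (r - t) *\<^sub>R w" for r
  define \<gamma> where "\<gamma> r = inv_into U \<phi> (l r)" for r
  define I where "I = l -` (\<phi> ` U)"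
  have l: "smooth_on UNIV l"
    unfolding l_def by (intro smooth_on_add smooth_on_scaleR smooth_on_diff smooth_on_const
        smooth_on_linear bounded_linear_ident open_UNIV)
  have I: "open I"
    unfolding I_def using continuous_open_vimage smooth_on_imp_continuous_on[OF l]
      open_chart_image[OF assms(1)] by (metis continuous_on_eq_continuous_at open_UNIV UNIV_I)
  have eq: "\<phi> (\<gamma> r) = l r" "\<gamma> r \<in> U" if "r \<in> I" for r
    using that f_inv_into_f inv_into_into unfolding I_def \<gamma>_def by (metis vimageE)+
  have t: "t \<in> I" "\<gamma> t = x" using assms inj_chart by (auto simp: I_def l_def \<gamma>_def)
  have "smooth_on I (\<phi> \<circ> \<gamma>)"
    by (rule smooth_on_cong[OF I smooth_on_mono[OF l]]) (auto simp: eq)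
  then have c: "smooth_curve_at A t \<gamma>"
    unfolding smooth_curve_at_def using assms(1) I t(1) eq(2) by blast
  have "(l has_derivative (\<lambda>r. r *\<^sub>R w)) (at t)"
    unfolding l_def by (auto intro!: derivative_eq_intros)
  then have "((\<phi> \<circ> \<gamma>) has_derivative (\<lambda>r. r *\<^sub>R w)) (at t)"
    by (rule has_derivative_transform_within_open[OF _ I t(1)]) (simp add: eq)
  then have "vector_derivative (\<phi> \<circ> \<gamma>) (at t) = w"
    by (intro vector_derivative_at) (simp add: has_vector_derivative_def)
  then show thesis
    using that[of "jet_rel A `` {(t, \<gamma>)}"] jet_class[OF c] assms t(2) by metis
qed

lemma time_chart:
  assumes "(I, \<tau>) \<in> time_charts"
  shows "open I" "smooth_on I \<tau>" "inj_on \<tau> I" "\<And>t. t \<in> I \<Longrightarrow> deriv \<tau> t \<noteq> 0"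
    and "open (\<tau> ` I)" "smooth_on (\<tau> ` I) (inv_into I \<tau>)" "smooth_on I (deriv \<tau>)"
proof -
  show t: "open I" "smooth_on I \<tau>" "inj_on \<tau> I" "\<And>t. t \<in> I \<Longrightarrow> deriv \<tau> t \<noteq> 0"
    using assms by (auto simp: time_charts_def)
  show "open (\<tau> ` I)" "smooth_on (\<tau> ` I) (inv_into I \<tau>)"
    using smooth_on_inv_into_real[OF t] by auto
  show "smooth_on I (deriv \<tau>)"
  proof (rule smooth_on_cong[OF t(1) smooth_on_frechet_derivative[OF t(2), of 1]])
    fix s assume "s \<in> I"
    have "\<tau> differentiable (at s)"
      using smooth_on_has_derivative[OF t(2) \<open>s \<in> I\<close>] differentiable_def by blast
    then have "(\<tau> has_derivative (*) (deriv \<tau> s)) (at s)"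
      using DERIV_deriv_iff_real_differentiable has_field_derivative_def by blast
    then show "frechet_derivative \<tau> (at s) 1 = deriv \<tau> s"
      using frechet_derivative_at by (metis mult.right_neutral)
  qed
qed

lemma time_chart_image_open:
  assumes "(I, \<tau>) \<in> time_charts" "open T" "T \<subseteq> I"
  shows "open (\<tau> ` T)"
  using time_chart(1-4)[OF assms(1)] assms(2,3)
  by (intro smooth_on_inv_into_real(1)) (auto intro: smooth_on_mono inj_on_subset)

lemma echarts_iff [simp]:
  "((I, \<tau>), (U, \<phi>)) \<in> echarts A \<longleftrightarrow> (I, \<tau>) \<in> time_charts \<and> (U, \<phi>) \<in> A"
  by (simp add: echarts_def)

lemma inj_on_ecoord:
  assumes "c \<in> echarts A"
  shows "inj_on (ecoord c) (edom A c)"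
proof -
  obtain I \<tau> U \<phi> where c: "c = ((I, \<tau>), (U, \<phi>))" by (metis surj_pair)
  have I: "(I, \<tau>) \<in> time_charts" and U: "(U, \<phi>) \<in> A" using assms by (auto simp: c)
  show ?thesis
  proof (rule inj_onI)
    fix p q assume pq: "p \<in> edom A c" "q \<in> edom A c" "ecoord c p = ecoord c q"
    then have "jet_time p = jet_time q" "jet_base p = jet_base q"
      using inj_onD[OF time_chart(3)[OF I]] inj_onD[OF inj_chart[OF U]]
      by (auto simp: c edom_eq ecoord_eq)
    then show "p = q"
      using pq time_chart(4)[OF I] U by (intro jet_eqI[of p q U \<phi>]) (auto simp: c edom_eq ecoord_eq)
  qed
qed

lemma einv_ecoord [simp]:
  "c \<in> echarts A \<Longrightarrow> p \<in> edom A c \<Longrightarrow> einv A c (ecoord c p) = p"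
  by (simp add: einv_def inj_on_ecoord)

text \<open>The velocity is unrestricted, so every chart image is an open cylinder; this makes the coordinate
  changes smooth maps between open sets.\<close>

lemma ecoord_image:
  assumes "(I, \<tau>) \<in> time_charts" "(U, \<phi>) \<in> A" "T \<subseteq> I" "W \<subseteq> U"
  shows "ecoord ((I, \<tau>), (U, \<phi>)) ` {p \<in> J1 A. jet_time p \<in> T \<and> jet_base p \<in> W} =
    \<tau> ` T \<times> \<phi> ` W \<times> UNIV" (is "?l = ?r")
proof
  show "?l \<subseteq> ?r" by (auto simp: ecoord_eq)
  show "?r \<subseteq> ?l"
  proof
    fix z assume "z \<in> ?r"
    then obtain t x v where z: "z = (\<tau> t, \<phi> x, v)" "t \<in> T" "x \<in> W" by auto
    obtain p where "p \<in> J1 A" "jet_time p = t" "jet_base p = x" "jet_vel \<phi> p = deriv \<tau> t *\<^sub>R v"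
      using jet_exists[OF assms(2)] z(3) assms(4) by blast
    then show "z \<in> ?l"
      using z assms(3) time_chart(4)[OF assms(1)] by (auto simp: ecoord_eq intro!: image_eqI[of _ _ p])
  qed
qed

lemma open_ecoord_image:
  assumes "(I, \<tau>) \<in> time_charts" "(U, \<phi>) \<in> A" "T \<subseteq> I" "W \<subseteq> U" "open T" "openin M W"
  shows "open (ecoord ((I, \<tau>), (U, \<phi>)) ` {p \<in> J1 A. jet_time p \<in> T \<and> jet_base p \<in> W})"
  unfolding ecoord_image[OF assms(1-4)]
  by (intro open_Times time_chart_image_open[OF assms(1)] open_image_chart[OF assms(2)] assms open_UNIV)

lemma edom_Int:
  "edom A ((I, \<tau>), (U, \<phi>)) \<inter> edom A ((J, \<upsilon>), (V, \<psi>)) =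
    {p \<in> J1 A. jet_time p \<in> I \<inter> J \<and> jet_base p \<in> U \<inter> V}"
  by (auto simp: edom_eq)

lemma open_overlap3:
  assumes "c \<in> echarts A" "c' \<in> echarts A" "c'' \<in> echarts A"
  shows "open (ecoord c ` (edom A c \<inter> edom A c' \<inter> edom A c''))"
proof -
  obtain I \<tau> U \<phi> J \<upsilon> V \<psi> K \<kappa> W \<omega>
    where [simp]: "c = ((I, \<tau>), (U, \<phi>))" "c' = ((J, \<upsilon>), (V, \<psi>))" "c'' = ((K, \<kappa>), (W, \<omega>))"
    by (metis surj_pair)
  have *: "edom A c \<inter> edom A c' \<inter> edom A c'' =
      {p \<in> J1 A. jet_time p \<in> I \<inter> J \<inter> K \<and> jet_base p \<in> U \<inter> V \<inter> W}"
    by (auto simp: edom_eq)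
  show ?thesis
    unfolding * unfolding \<open>c = _\<close>
    by (rule open_ecoord_image)
      (use assms in \<open>auto intro!: open_Int openin_Int simp: time_chart openin_chart\<close>)
qed

lemma open_overlap:
  "c \<in> echarts A \<Longrightarrow> c' \<in> echarts A \<Longrightarrow> open (ecoord c ` (edom A c \<inter> edom A c'))"
  using open_overlap3[of c c' c] by (simp add: Int_absorb2 Int_commute Int_left_commute)

lemma open_ecoord: "c \<in> echarts A \<Longrightarrow> open (ecoord c ` edom A c)"
  using open_overlap[of c c] by simp

text \<open>On the velocities a coordinate change acts by the Jacobian of the change of base coordinates,
  divided by the derivative of the change of time.\<close>

lemma transition_eq:
  assumes "((I, \<tau>), (U, \<phi>)) \<in> echarts A" "((J, \<upsilon>), (V, \<psi>)) \<in> echarts A"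
    and "(s, x, v) \<in> ecoord ((I, \<tau>), (U, \<phi>)) ` (edom A ((I, \<tau>), (U, \<phi>)) \<inter> edom A ((J, \<upsilon>), (V, \<psi>)))"
  defines "t \<equiv> inv_into I \<tau> s"
  shows "ecoord ((J, \<upsilon>), (V, \<psi>)) (einv A ((I, \<tau>), (U, \<phi>)) (s, x, v)) =
    (\<upsilon> t, (\<psi> \<circ> inv_into U \<phi>) x,
     (deriv \<tau> t * inverse (deriv \<upsilon> t)) *\<^sub>R frechet_derivative (\<psi> \<circ> inv_into U \<phi>) (at x) v)"
proof -
  obtain p where p: "p \<in> edom A ((I, \<tau>), (U, \<phi>))" "p \<in> edom A ((J, \<upsilon>), (V, \<psi>))"
    "(s, x, v) = ecoord ((I, \<tau>), (U, \<phi>)) p"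
    using assms(3) by blast
  have I: "(I, \<tau>) \<in> time_charts" and U: "(U, \<phi>) \<in> A" and V: "(V, \<psi>) \<in> A" using assms(1,2) by auto
  note p' = p(1,2)[unfolded edom_eq, simplified]
  have x: "x = \<phi> (jet_base p)" "v = jet_vel \<phi> p /\<^sub>R deriv \<tau> (jet_time p)" "jet_time p = t"
    using p(3) time_chart(3)[OF I] p' unfolding t_def ecoord_eq by auto
  have lin: "linear (frechet_derivative (\<psi> \<circ> inv_into U \<phi>) (at x))"
    using has_derivative_linear[OF smooth_on_has_derivative[OF smooth_transition[OF U V]]] p' x(1) by blast
  have nz: "deriv \<tau> t \<noteq> 0" using time_chart(4)[OF I] p' x(3) by blast
  have "jet_vel \<phi> p = deriv \<tau> t *\<^sub>R v" using nz x by simp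
  then have "jet_vel \<psi> p = deriv \<tau> t *\<^sub>R frechet_derivative (\<psi> \<circ> inv_into U \<phi>) (at x) v"
    using jet_vel_transition[OF _ U V] p' x(1) linear_scale[OF lin] by simp
  moreover have "einv A ((I, \<tau>), (U, \<phi>)) (s, x, v) = p"
    unfolding p(3) by (rule einv_ecoord[OF assms(1) p(1)])
  ultimately show ?thesis
    using x(1,3) p' inj_chart[OF U] by (simp add: ecoord_eq mult.commute)
qed

lemma smooth_transition_jet:
  assumes "c \<in> echarts A" "c' \<in> echarts A"
  shows "smooth_on (ecoord c ` (edom A c \<inter> edom A c')) (\<lambda>z. ecoord c' (einv A c z))"
proof -
  obtain I \<tau> U \<phi> J \<upsilon> V \<psi> where c: "c = ((I, \<tau>), (U, \<phi>))" "c' = ((J, \<upsilon>), (V, \<psi>))"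
    by (metis surj_pair)
  have I: "(I, \<tau>) \<in> time_charts" and J: "(J, \<upsilon>) \<in> time_charts"
    and U: "(U, \<phi>) \<in> A" and V: "(V, \<psi>) \<in> A" using assms by (auto simp: c)
  let ?S = "ecoord c ` (edom A c \<inter> edom A c')"
  note op = open_overlap[OF assms]
  have S: "?S = \<tau> ` (I \<inter> J) \<times> \<phi> ` (U \<inter> V) \<times> UNIV"
    unfolding c edom_Int by (rule ecoord_image[OF I U]) auto
  let ?t = "\<lambda>z::real \<times> (real^'n) \<times> (real^'n). inv_into I \<tau> (fst z)"
  have fst: "smooth_on ?S fst" and fs: "smooth_on ?S (\<lambda>z. fst (snd z))"
    and ss: "smooth_on ?S (\<lambda>z. snd (snd z))"
    by (intro smooth_on_linear bounded_linear_fst bounded_linear_compose[OF bounded_linear_fst]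
        bounded_linear_compose[OF bounded_linear_snd] bounded_linear_snd)+
  have t: "smooth_on ?S ?t"
    by (rule smooth_on_compose[OF op time_chart(6)[OF I] fst]) (auto simp: S)
  have tI: "?t ` ?S \<subseteq> I" "?t ` ?S \<subseteq> J"
    using time_chart(3)[OF I] by (auto simp: S)
  show ?thesis
  proof (rule smooth_on_cong[OF op])
    show "smooth_on ?S (\<lambda>z. (\<upsilon> (?t z), (\<psi> \<circ> inv_into U \<phi>) (fst (snd z)),
      (deriv \<tau> (?t z) * inverse (deriv \<upsilon> (?t z))) *\<^sub>R
        frechet_derivative (\<psi> \<circ> inv_into U \<phi>) (at (fst (snd z))) (snd (snd z))))"
      using tI time_chart(4)[OF J]
      by (intro smooth_on_Pair op smooth_on_scaleR smooth_on_mult smooth_on_inverse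
          smooth_on_compose[OF op time_chart(2)[OF J] t] smooth_on_compose[OF op time_chart(7)[OF J] t]
          smooth_on_compose[OF op time_chart(7)[OF I] t]
          smooth_on_compose[OF op smooth_transition[OF U V] fs]
          smooth_on_frechet_derivative_compose[OF op smooth_transition[OF U V] fs] ss)
        (auto simp: S inv_into_f_f[OF time_chart(3)[OF I]])
    show "(\<upsilon> (?t z), (\<psi> \<circ> inv_into U \<phi>) (fst (snd z)),
      (deriv \<tau> (?t z) * inverse (deriv \<upsilon> (?t z))) *\<^sub>R
        frechet_derivative (\<psi> \<circ> inv_into U \<phi>) (at (fst (snd z))) (snd (snd z))) =
      ecoord c' (einv A c z)" if "z \<in> ?S" for z
      by (cases z) (use transition_eq[OF assms[unfolded c], folded c] that in simp)
  qed
qed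

lemma dtrans_has_derivative:
  assumes "c \<in> echarts A" "c' \<in> echarts A" "p \<in> edom A c" "p \<in> edom A c'"
  shows "((\<lambda>z. ecoord c' (einv A c z)) has_derivative dtrans A c c' p) (at (ecoord c p))"
  using smooth_on_has_derivative[OF smooth_transition_jet[OF assms(1,2)], of "ecoord c p"] assms(3,4)
  by (simp add: dtrans_def comp_def)

lemma linear_dtrans:
  "c \<in> echarts A \<Longrightarrow> c' \<in> echarts A \<Longrightarrow> p \<in> edom A c \<Longrightarrow> p \<in> edom A c' \<Longrightarrow> linear (dtrans A c c' p)"
  using dtrans_has_derivative has_derivative_linear by blast

lemma dtrans_trans:
  assumes "c \<in> echarts A" "c' \<in> echarts A" "c'' \<in> echarts A"
    and "p \<in> edom A c" "p \<in> edom A c'" "p \<in> edom A c''"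
  shows "dtrans A c' c'' p (dtrans A c c' p w) = dtrans A c c'' p w"
proof -
  have "((\<lambda>z. ecoord c'' (einv A c' z)) has_derivative dtrans A c' c'' p)
      (at (ecoord c' (einv A c (ecoord c p))))"
    using dtrans_has_derivative[of c' c'' p] assms by simp
  from has_derivative_compose[OF dtrans_has_derivative[of c c' p] this] assms
  have "((\<lambda>z. ecoord c'' (einv A c' (ecoord c' (einv A c z)))) has_derivative
      (\<lambda>w. dtrans A c' c'' p (dtrans A c c' p w))) (at (ecoord c p))"
    by simp
  then have "((\<lambda>z. ecoord c'' (einv A c z)) has_derivative
      (\<lambda>w. dtrans A c' c'' p (dtrans A c c' p w))) (at (ecoord c p))"
    by (rule has_derivative_transform_within_open[OF _ open_overlap3[OF assms(1-3)]])
      (use assms in auto)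
  from has_derivative_unique[OF this dtrans_has_derivative] assms show ?thesis by metis
qed

lemma dtrans_refl:
  assumes "c \<in> echarts A" "p \<in> edom A c"
  shows "dtrans A c c p w = w"
proof -
  have "((\<lambda>z. z) has_derivative dtrans A c c p) (at (ecoord c p))"
    by (rule has_derivative_transform_within_open[OF dtrans_has_derivative[OF assms(1,1,2,2)]
          open_ecoord[OF assms(1)]])
      (use assms in auto)
  from has_derivative_unique[OF this has_derivative_ident] show ?thesis by metis
qed

text \<open>The Jacobian of a coordinate change is block triangular, and its diagonal blocks are tied
  together: if \<open>1/k\<close> is the derivative of the change of time and \<open>B\<close> the Jacobian of the
  change of base coordinates, then the vertical block is \<open>k B\<close>.\<close>

lemma dtrans_blocks:
  assumes "c \<in> echarts A" "c' \<in> echarts A" "p \<in> edom A c" "p \<in> edom A c'"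
  obtains k B where "k \<noteq> 0" "linear B"
    "\<And>w. fst (dtrans A c c' p w) = inverse k * fst w"
    "\<And>w. fst (snd (dtrans A c c' p w)) = B (fst (snd w))"
    "\<And>y. dtrans A c c' p (0, 0, y) = (0, 0, k *\<^sub>R B y)"
proof -
  obtain I \<tau> U \<phi> J \<upsilon> V \<psi> where c: "c = ((I, \<tau>), (U, \<phi>))" "c' = ((J, \<upsilon>), (V, \<psi>))"
    by (metis surj_pair)
  have I: "(I, \<tau>) \<in> time_charts" and J: "(J, \<upsilon>) \<in> time_charts"
    and U: "(U, \<phi>) \<in> A" and V: "(V, \<psi>) \<in> A" using assms by (auto simp: c)
  let ?S = "ecoord c ` (edom A c \<inter> edom A c')"
  note op = open_overlap[OF assms(1,2)]
  have S: "?S = \<tau> ` (I \<inter> J) \<times> \<phi> ` (U \<inter> V) \<times> UNIV"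
    unfolding c edom_Int by (rule ecoord_image[OF I U]) auto
  obtain s x v where z: "ecoord c p = (s, x, v)" by (metis surj_pair)
  have zS: "(s, x, v) \<in> ?S" using assms z by (metis IntI image_eqI)
  define t where "t = inv_into I \<tau> s"
  have t: "t \<in> I" "t \<in> J" "\<tau> t = s"
    using zS time_chart(3)[OF I] by (auto simp: S t_def)
  define k where "k = deriv \<tau> t * inverse (deriv \<upsilon> t)"
  define B where "B = frechet_derivative (\<psi> \<circ> inv_into U \<phi>) (at x)"
  have k: "k \<noteq> 0" using time_chart(4)[OF I t(1)] time_chart(4)[OF J t(2)] by (simp add: k_def)
  have B: "((\<psi> \<circ> inv_into U \<phi>) has_derivative B) (at x)"
    unfolding B_def by (rule smooth_on_has_derivative[OF smooth_transition[OF U V]])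
      (use zS in \<open>auto simp: S\<close>)
  have eq: "ecoord c' (einv A c z) = (\<upsilon> (inv_into I \<tau> (fst z)), (\<psi> \<circ> inv_into U \<phi>) (fst (snd z)),
      (deriv \<tau> (inv_into I \<tau> (fst z)) * inverse (deriv \<upsilon> (inv_into I \<tau> (fst z)))) *\<^sub>R
        frechet_derivative (\<psi> \<circ> inv_into U \<phi>) (at (fst (snd z))) (snd (snd z)))"
    if "z \<in> ?S" for z
    by (cases z) (use transition_eq[OF assms(1,2)[unfolded c], folded c] that in simp)
  note D = dtrans_has_derivative[OF assms, unfolded z]
  have D1: "(\<tau> has_field_derivative deriv \<tau> t) (at t)" "(\<upsilon> has_field_derivative deriv \<upsilon> t) (at t)"
    using smooth_on_has_derivative[OF time_chart(2)[OF I] t(1)]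
      smooth_on_has_derivative[OF time_chart(2)[OF J] t(2)]
    by (auto simp: DERIV_deriv_iff_real_differentiable differentiable_def)
  have D2: "(inv_into I \<tau> has_derivative (\<lambda>v. inverse (deriv \<tau> t) * v)) (at s)"
    unfolding t(3)[symmetric]
    by (rule has_derivative_inverse_strong[OF time_chart(1)[OF I] t(1)
          smooth_on_imp_continuous_on[OF time_chart(2)[OF I]], where f'="\<lambda>v. deriv \<tau> t * v"])
      (use D1(1) time_chart(3,4)[OF I] t(1) in \<open>auto simp: has_field_derivative_def fun_eq_iff\<close>)
  have D3: "((\<lambda>r. \<upsilon> (inv_into I \<tau> r)) has_derivative (\<lambda>v. deriv \<upsilon> t * (inverse (deriv \<tau> t) * v))) (at s)"
    by (rule has_derivative_compose[OF D2]) (use D1(2) in \<open>simp add: has_field_derivative_def t_def\<close>)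
  have "((\<lambda>z. \<upsilon> (inv_into I \<tau> (fst z))) has_derivative
      (\<lambda>w. deriv \<upsilon> t * (inverse (deriv \<tau> t) * fst w))) (at (s, x, v))"
    by (rule has_derivative_compose[of fst, OF has_derivative_fst[OF has_derivative_ident]])
      (use D3 in simp)
  then have "((\<lambda>z. fst (ecoord c' (einv A c z))) has_derivative
      (\<lambda>w. deriv \<upsilon> t * (inverse (deriv \<tau> t) * fst w))) (at (s, x, v))"
    by (rule has_derivative_transform_within_open[OF _ op zS]) (simp add: eq)
  from has_derivative_unique[OF has_derivative_fst[OF D] this]
  have 1: "fst (dtrans A c c' p w) = inverse k * fst w" for w
    by (cases w) (simp add: k_def fun_eq_iff)
  have "((\<lambda>z. (\<psi> \<circ> inv_into U \<phi>) (fst (snd z))) has_derivative (\<lambda>w. B (fst (snd w)))) (at (s, x, v))"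
    by (rule has_derivative_compose[where f="\<lambda>z. fst (snd z)" and f'="\<lambda>w. fst (snd w)"
          and g="\<psi> \<circ> inv_into U \<phi>" and g'=B])
      (use B in \<open>auto intro!: derivative_intros simp del: comp_apply\<close>)
  then have "((\<lambda>z. fst (snd (ecoord c' (einv A c z)))) has_derivative (\<lambda>w. B (fst (snd w)))) (at (s, x, v))"
    by (rule has_derivative_transform_within_open[OF _ op zS]) (simp add: eq)
  from has_derivative_unique[OF has_derivative_fst[OF has_derivative_snd[OF D]] this]
  have 2: "fst (snd (dtrans A c c' p w)) = B (fst (snd w))" for w
    by (cases w) (simp add: fun_eq_iff)
  have linB: "linear B" using B has_derivative_linear by blast
  \<comment> \<open>With time and base point fixed, the new velocity is linear in the old one.\<close>
  have "((\<lambda>h. snd (snd (ecoord c' (einv A c (s, x, v + h))))) has_derivative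
      (\<lambda>h. snd (snd (dtrans A c c' p (0, 0, h))))) (at 0)"
    by (rule has_derivative_compose[of "\<lambda>h. (s, x, v + h)" "\<lambda>h. (0, 0, h)"])
      (auto intro!: derivative_eq_intros has_derivative_snd D)
  moreover have "(\<lambda>h. snd (snd (ecoord c' (einv A c (s, x, v + h))))) = (\<lambda>h. k *\<^sub>R B v + k *\<^sub>R B h)"
  proof
    fix h
    have "(s, x, v + h) \<in> ?S" using zS by (auto simp: S)
    from eq[OF this] show "snd (snd (ecoord c' (einv A c (s, x, v + h)))) = k *\<^sub>R B v + k *\<^sub>R B h"
      using linear_add[OF linB, of v h]
      by (simp add: k_def t_def B_def scaleR_right_distrib)
  qed
  moreover have "((\<lambda>h. k *\<^sub>R B v + k *\<^sub>R B h) has_derivative (\<lambda>h. k *\<^sub>R B h)) (at 0)"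
    using linear_imp_has_derivative[OF linB] by (auto intro!: derivative_eq_intros)
  ultimately have "snd (snd (dtrans A c c' p (0, 0, y))) = k *\<^sub>R B y" for y
    using has_derivative_unique by metis
  then have "dtrans A c c' p (0, 0, y) = (0, 0, k *\<^sub>R B y)" for y
    using 1[of "(0, 0, y)"] 2[of "(0, 0, y)"] linear_0[OF linB] by (simp add: prod_eq_iff)
  with k linB 1 2 show thesis using that by blast
qed

end

section \<open>Extending local objects to the whole bundle\<close>

context jet_space
begin

lemma einv_mem:
  assumes "z \<in> ecoord c ` edom A c"
  shows "einv A c z \<in> edom A c" "ecoord c (einv A c z) = z"
  using inv_into_into[OF assms] f_inv_into_f[OF assms] by (simp_all add: einv_def)

text \<open>A compact part of one chart is closed in the whole bundle. This is where the Hausdorff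
  property of the base enters: the projection of the compact set to the base is compact,
  hence closed.\<close>

lemma away_from_compact:
  assumes c: "c \<in> echarts A" "c' \<in> echarts A"
    and K: "compact K" "K \<subseteq> ecoord c ` edom A c"
    and q: "q \<in> edom A c'" "q \<notin> edom A c"
  obtains T where "open T" "ecoord c' q \<in> T" "T \<subseteq> ecoord c' ` edom A c'"
    "\<And>r. r \<in> edom A c \<Longrightarrow> r \<in> edom A c' \<Longrightarrow> ecoord c' r \<in> T \<Longrightarrow> ecoord c r \<notin> K"
proof -
  note result = that
  obtain I \<tau> U \<phi> J \<upsilon> V \<psi> where cc: "c = ((I, \<tau>), (U, \<phi>))" "c' = ((J, \<upsilon>), (V, \<psi>))"
    by (metis surj_pair)
  have I: "(I, \<tau>) \<in> time_charts" and J: "(J, \<upsilon>) \<in> time_charts"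
    and U: "(U, \<phi>) \<in> A" and V: "(V, \<psi>) \<in> A" using c by (auto simp: cc)
  define T0 where "T0 = inv_into I \<tau> ` fst ` K"
  define B0 where "B0 = {x \<in> U. \<phi> x \<in> fst ` snd ` K}"
  have K12: "fst ` K \<subseteq> \<tau> ` I" "fst ` snd ` K \<subseteq> \<phi> ` U"
    using K(2) by (auto simp: cc ecoord_eq edom_eq)
  have "compact T0"
    unfolding T0_def
    by (intro compact_continuous_image continuous_on_fst continuous_on_id K(1)
        continuous_on_subset[OF smooth_on_imp_continuous_on[OF time_chart(6)[OF I]] K12(1)])
  then have T0: "closed T0" by (rule compact_imp_closed)
  have "compactin (top_of_set (\<phi> ` U)) (fst ` snd ` K)"
    using K12(2) by (auto simp: compactin_subtopology intro!: compact_continuous_image continuous_intros K(1))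
  moreover have "\<phi> ` {x \<in> U. \<phi> x \<in> Z} = Z" if "Z \<subseteq> \<phi> ` U" for Z
    using that by blast
  note this[OF K12(2), folded B0_def]
  moreover have "B0 \<subseteq> topspace (subtopology M U)"
    using openin_subset[OF openin_chart[OF U]] by (auto simp: B0_def)
  ultimately have "compactin (subtopology M U) B0"
    using homeomorphic_map_compactness[OF homeo_chart[OF U]] by metis
  then have "compactin M B0" by (simp add: compactin_subtopology)
  moreover have "Hausdorff_space M" using manifold by (simp add: smooth_manifold_def)
  ultimately have B0: "closedin M B0" by (simp add: compactin_imp_closedin)
  have *: thesis if TW: "open T" "T \<subseteq> J" "openin M W" "W \<subseteq> V" "jet_time q \<in> T" "jet_base q \<in> W"
    and dis: "T \<inter> T0 = {} \<or> W \<inter> B0 = {}" for T W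
  proof (rule result)
    let ?P = "{p \<in> J1 A. jet_time p \<in> T \<and> jet_base p \<in> W}"
    have P: "?P \<subseteq> edom A c'" using TW by (auto simp: cc edom_eq)
    show "open (ecoord c' ` ?P)"
      unfolding cc by (rule open_ecoord_image[OF J V TW(2,4,1,3)])
    show "ecoord c' q \<in> ecoord c' ` ?P" using TW q(1) by (auto simp: cc edom_eq)
    show "ecoord c' ` ?P \<subseteq> ecoord c' ` edom A c'" using P by blast
    fix r assume r: "r \<in> edom A c" "r \<in> edom A c'" "ecoord c' r \<in> ecoord c' ` ?P"
    then obtain r' where "r' \<in> ?P" "ecoord c' r = ecoord c' r'" by blast
    then have "r \<in> ?P" using inj_onD[OF inj_on_ecoord[OF c(2)], of r r'] r(2) P by blast
    moreover have "jet_time r \<in> T0 \<and> jet_base r \<in> B0" if "ecoord c r \<in> K"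
    proof -
      have \<tau>: "\<tau> (jet_time r) \<in> fst ` K" and \<phi>: "\<phi> (jet_base r) \<in> fst ` snd ` K"
        using imageI[OF that, of fst] imageI[OF imageI[OF that, of snd], of fst]
        by (simp_all add: cc ecoord_eq)
      have "inv_into I \<tau> (\<tau> (jet_time r)) \<in> T0" unfolding T0_def by (rule imageI[OF \<tau>])
      then show ?thesis
        using r(1) time_chart(3)[OF I] \<phi> by (simp add: cc edom_eq B0_def)
    qed
    ultimately show "ecoord c r \<notin> K" using dis by blast
  qed
  have "jet_time q \<notin> I \<or> jet_base q \<notin> U" using q by (auto simp: cc edom_eq)
  then show thesis
  proof
    assume "jet_time q \<notin> I"
    moreover have "T0 \<subseteq> I" using K12(1) inv_into_into[of _ \<tau> I] by (auto simp: T0_def)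
    ultimately show thesis
      using q(1) time_chart(1)[OF J] T0 openin_chart[OF V]
      by (intro *[of "J - T0" V]) (auto simp: cc edom_eq)
  next
    assume "jet_base q \<notin> U"
    then show thesis
      using q(1) time_chart(1)[OF J] openin_diff[OF openin_chart[OF V] B0]
      by (intro *[of J "V - B0"]) (auto simp: cc edom_eq B0_def)
  qed
qed

text \<open>Extension by zero: every point of the chart \<open>c'\<close> either lies in \<open>c\<close>, where smoothness is assumed,
  or has a neighbourhood that misses the support.\<close>

lemma smooth_local_if_compact_support:
  assumes c: "c \<in> echarts A" "c' \<in> echarts A"
    and K: "compact K" "K \<subseteq> ecoord c ` edom A c"
    and supp: "\<And>q. q \<in> edom A c' \<Longrightarrow> H q \<noteq> 0 \<Longrightarrow> q \<in> edom A c \<and> ecoord c q \<in> K"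
    and H: "smooth_on (ecoord c' ` (edom A c' \<inter> edom A c)) (H \<circ> einv A c')"
  shows "smooth_local A c' H"
  unfolding smooth_local_def
proof (rule smooth_on_local)
  fix z assume "z \<in> ecoord c' ` edom A c'"
  then obtain q where q: "q \<in> edom A c'" "z = ecoord c' q" by auto
  show "\<exists>T. open T \<and> z \<in> T \<and> smooth_on T (H \<circ> einv A c')"
  proof (cases "q \<in> edom A c")
    case True
    then show ?thesis using q H open_overlap[OF c(2,1)] by blast
  next
    case False
    obtain T where T: "open T" "ecoord c' q \<in> T" "T \<subseteq> ecoord c' ` edom A c'"
      "\<And>r. r \<in> edom A c \<Longrightarrow> r \<in> edom A c' \<Longrightarrow> ecoord c' r \<in> T \<Longrightarrow> ecoord c r \<notin> K"
      using away_from_compact[OF c K q(1) False] by blast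
    have "smooth_on T (H \<circ> einv A c')"
    proof (rule smooth_on_cong[OF T(1) smooth_on_const])
      fix z assume z: "z \<in> T"
      then have "z \<in> ecoord c' ` edom A c'" using T(3) by blast
      note z' = einv_mem[OF this]
      show "0 = (H \<circ> einv A c') z" using supp[of "einv A c' z"] T(4)[of "einv A c' z"] z z' by auto
    qed
    then show ?thesis using T q by blast
  qed
qed

lemma jet_open_preimage:
  assumes "c \<in> echarts A" "open S"
  shows "jet_open A {q \<in> edom A c. ecoord c q \<in> S}" (is "jet_open A ?W")
  unfolding jet_open_def
proof (intro conjI ballI)
  show "?W \<subseteq> J1 A" by (auto simp: edom_def)
  fix c' assume c': "c' \<in> echarts A"
  have "ecoord c' ` (?W \<inter> edom A c') =
      ecoord c' ` (edom A c' \<inter> edom A c) \<inter> (\<lambda>z. ecoord c (einv A c' z)) -` S"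
    using c' by (auto simp: image_iff)
  then show "open (ecoord c' ` (?W \<inter> edom A c'))"
    using continuous_open_preimage[OF smooth_on_imp_continuous_on[OF smooth_transition_jet[OF c' assms(1)]]
        open_overlap[OF c' assms(1)] assms(2)] by simp
qed

lemma jet_open_edom:
  assumes "c \<in> echarts A"
  shows "jet_open A (edom A c)"
  using jet_open_preimage[OF assms open_UNIV] by simp

lemma jet_open_Int:
  assumes "jet_open A V" "jet_open A W"
  shows "jet_open A (V \<inter> W)"
  unfolding jet_open_def
proof (intro conjI ballI)
  show "V \<inter> W \<subseteq> J1 A" using assms by (auto simp: jet_open_def)
  fix c assume c: "c \<in> echarts A"
  have "ecoord c ` (V \<inter> W \<inter> edom A c) = ecoord c ` (V \<inter> edom A c) \<inter> ecoord c ` (W \<inter> edom A c)"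
    using inj_on_ecoord[OF c] by (auto simp: inj_on_def)
  then show "open (ecoord c ` (V \<inter> W \<inter> edom A c))"
    using assms c by (auto simp: jet_open_def)
qed

text \<open>The compact set bounds the support inside the coordinates of a single chart. The set \<open>S\<close> is the region
  to which a field is to be localized.\<close>

definition cutoff :: "('m, 'n) echart \<Rightarrow> 'm jet set \<Rightarrow> ('m jet \<Rightarrow> real) \<Rightarrow> bool" where
  "cutoff c S f \<longleftrightarrow> smooth_fun A f \<and>
     (\<exists>K. compact K \<and> K \<subseteq> ecoord c ` (S \<inter> edom A c) \<and>
        (\<forall>q. f q \<noteq> 0 \<longrightarrow> q \<in> S \<and> q \<in> edom A c \<and> ecoord c q \<in> K))"

lemma cutoffD:
  assumes "cutoff c S f"
  shows "smooth_fun A f" "f q \<noteq> 0 \<Longrightarrow> q \<in> S" "f q \<noteq> 0 \<Longrightarrow> q \<in> edom A c"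
  using assms by (auto simp: cutoff_def)

lemma exists_cutoff:
  assumes c: "c \<in> echarts A" and p: "p \<in> edom A c" "p \<in> S" and S: "jet_open A S"
  obtains f W where "cutoff c S f" "jet_open A W" "p \<in> W" "W \<subseteq> edom A c" "\<And>q. q \<in> W \<Longrightarrow> f q = 1"
proof -
  have "open (ecoord c ` (S \<inter> edom A c))" using S c by (simp add: jet_open_def)
  moreover have "ecoord c p \<in> ecoord c ` (S \<inter> edom A c)" using p by blast
  ultimately obtain e where e: "e > 0" "cball (ecoord c p) e \<subseteq> ecoord c ` (S \<inter> edom A c)"
    using open_contains_cball by blast
  define K where "K = cball (ecoord c p) (2 * (e / 2))"
  have K: "compact K" "K \<subseteq> ecoord c ` (S \<inter> edom A c)"
    using e(2) by (simp_all add: K_def)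
  obtain \<beta> :: "'n coords \<Rightarrow> real" where \<beta>: "smooth_on UNIV \<beta>"
    "\<And>z. z \<in> ball (ecoord c p) (e / 2) \<Longrightarrow> \<beta> z = 1" "\<And>z. z \<notin> K \<Longrightarrow> \<beta> z = 0"
    by (rule exists_plateau[OF half_gt_zero[OF e(1)], of "ecoord c p", folded K_def]) blast
  define f where "f q = (if q \<in> edom A c then \<beta> (ecoord c q) else 0)" for q
  define W where "W = {q \<in> edom A c. ecoord c q \<in> ball (ecoord c p) (e / 2)}"
  have supp: "q \<in> S \<and> q \<in> edom A c \<and> ecoord c q \<in> K" if "f q \<noteq> 0" for q
  proof -
    have q: "q \<in> edom A c" "ecoord c q \<in> K"
      using that \<beta>(3)[of "ecoord c q"] unfolding f_def by metis+
    then obtain q' where "q' \<in> S \<inter> edom A c" "ecoord c q = ecoord c q'" using K(2) by blast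
    then have "q \<in> S" using inj_onD[OF inj_on_ecoord[OF c], of q q'] q by blast
    then show ?thesis using q by blast
  qed
  have "smooth_local A c' f" if c': "c' \<in> echarts A" for c'
  proof (rule smooth_local_if_compact_support[OF c c' K(1)])
    show "K \<subseteq> ecoord c ` edom A c" using K(2) by blast
    show "smooth_on (ecoord c' ` (edom A c' \<inter> edom A c)) (f \<circ> einv A c')"
      by (rule smooth_on_cong[OF open_overlap[OF c' c]
            smooth_on_compose[OF open_overlap[OF c' c] \<beta>(1) smooth_transition_jet[OF c' c]]])
        (use c' in \<open>auto simp: f_def\<close>)
  qed (use supp in blast)
  then have "cutoff c S f"
    unfolding cutoff_def smooth_fun_def
    by (intro conjI ballI exI[of _ K] allI impI K) (simp_all add: supp)
  moreover have "jet_open A W" unfolding W_def by (rule jet_open_preimage[OF c open_ball])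
  ultimately show thesis
    by (rule that) (simp_all add: W_def f_def \<beta>(2) p(1) e(1) subset_iff)
qed

lemma smooth_fun_extend:
  assumes c: "c \<in> echarts A" and f: "cutoff c S f" and h: "smooth_local A c h"
  shows "smooth_fun A (\<lambda>q. f q * h q)"
  unfolding smooth_fun_def
proof
  fix c' assume c': "c' \<in> echarts A"
  obtain K where K: "compact K" "K \<subseteq> ecoord c ` edom A c"
    "\<And>q. f q \<noteq> 0 \<Longrightarrow> q \<in> edom A c \<and> ecoord c q \<in> K"
    using f unfolding cutoff_def by blast
  note op = open_overlap[OF c' c]
  show "smooth_local A c' (\<lambda>q. f q * h q)"
  proof (rule smooth_local_if_compact_support[OF c c' K(1,2)])
    show "q \<in> edom A c \<and> ecoord c q \<in> K" if "f q * h q \<noteq> 0" for q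
      using that by (intro K(3)) simp
    have f': "smooth_on (ecoord c' ` (edom A c' \<inter> edom A c)) (f \<circ> einv A c')"
      using cutoffD(1)[OF f] c' unfolding smooth_fun_def smooth_local_def
      by (intro smooth_on_mono[OF _ image_mono[OF Int_lower1]]) blast
    have "smooth_on (ecoord c' ` (edom A c' \<inter> edom A c)) (\<lambda>z. (h \<circ> einv A c) (ecoord c (einv A c' z)))"
      by (rule smooth_on_compose[OF op h[unfolded smooth_local_def] smooth_transition_jet[OF c' c]])
        (use c' in auto)
    then have "smooth_on (ecoord c' ` (edom A c' \<inter> edom A c)) (h \<circ> einv A c')"
      by (rule smooth_on_cong[OF op]) (use c c' in auto)
    with f' show "smooth_on (ecoord c' ` (edom A c' \<inter> edom A c)) ((\<lambda>q. f q * h q) \<circ> einv A c')"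
      unfolding comp_def by (rule smooth_on_mult[OF op])
  qed
qed

lemma vfields_zero: "X \<in> vfields A \<Longrightarrow> \<not> (c \<in> echarts A \<and> p \<in> edom A c) \<Longrightarrow> X c p = 0"
  unfolding vfields_def by blast

lemma vfields_trans:
  "X \<in> vfields A \<Longrightarrow> c \<in> echarts A \<Longrightarrow> c' \<in> echarts A \<Longrightarrow> p \<in> edom A c \<Longrightarrow> p \<in> edom A c' \<Longrightarrow>
    X c' p = dtrans A c c' p (X c p)"
  unfolding vfields_def by blast

lemma vfields_smooth: "X \<in> vfields A \<Longrightarrow> c \<in> echarts A \<Longrightarrow> smooth_local A c (X c)"
  unfolding vfields_def by blast

lemma vfieldsI:
  assumes "\<And>c. c \<in> echarts A \<Longrightarrow> smooth_local A c (X c)"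
    and "\<And>c c' p. c \<in> echarts A \<Longrightarrow> c' \<in> echarts A \<Longrightarrow> p \<in> edom A c \<Longrightarrow> p \<in> edom A c' \<Longrightarrow>
      X c' p = dtrans A c c' p (X c p)"
    and "\<And>c p. \<not> (c \<in> echarts A \<and> p \<in> edom A c) \<Longrightarrow> X c p = 0"
  shows "X \<in> vfields A"
  unfolding vfields_def using assms by blast

text \<open>The field \<open>f \<xi>\<close>, given in the chart \<open>c\<close> and transported to the other charts by the Jacobians.\<close>

definition vextend ::
  "('m, 'n) echart \<Rightarrow> ('m jet \<Rightarrow> real) \<Rightarrow> ('m jet \<Rightarrow> 'n coords) \<Rightarrow> ('m, 'n) vfield" where
  "vextend c f \<xi> = (\<lambda>c' q. if c' \<in> echarts A \<and> q \<in> edom A c' \<and> q \<in> edom A c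
     then f q *\<^sub>R dtrans A c c' q (\<xi> q) else 0)"

lemma vextend_chart:
  "c \<in> echarts A \<Longrightarrow> q \<in> edom A c \<Longrightarrow> vextend c f \<xi> c q = f q *\<^sub>R \<xi> q"
  by (simp add: vextend_def dtrans_refl)

lemma vextend_in_vfields:
  assumes c: "c \<in> echarts A" and f: "cutoff c S f" and \<xi>: "smooth_local A c \<xi>"
  shows "vextend c f \<xi> \<in> vfields A"
proof -
  obtain K where K: "compact K" "K \<subseteq> ecoord c ` edom A c"
    "\<And>q. f q \<noteq> 0 \<Longrightarrow> q \<in> edom A c \<and> ecoord c q \<in> K"
    using f unfolding cutoff_def by blast
  show ?thesis
  proof (rule vfieldsI)
    fix c' assume c': "c' \<in> echarts A"
    show "smooth_local A c' (vextend c f \<xi> c')"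
  proof (rule smooth_local_if_compact_support[OF c c' K(1,2)])
    note op = open_overlap[OF c' c]
    show "q \<in> edom A c \<and> ecoord c q \<in> K" if "vextend c f \<xi> c' q \<noteq> 0" for q
      using that by (intro K(3)) (auto simp: vextend_def split: if_splits)
    have f': "smooth_on (ecoord c' ` (edom A c' \<inter> edom A c)) (f \<circ> einv A c')"
      using cutoffD(1)[OF f] c' unfolding smooth_fun_def smooth_local_def
      by (intro smooth_on_mono[OF _ image_mono[OF Int_lower1]]) blast
    have im: "(\<lambda>z. ecoord c (einv A c' z)) ` ecoord c' ` (edom A c' \<inter> edom A c)
        \<subseteq> ecoord c ` (edom A c \<inter> edom A c')"
      using c' by auto
    have x: "smooth_on (ecoord c' ` (edom A c' \<inter> edom A c)) (\<lambda>z. (\<xi> \<circ> einv A c) (ecoord c (einv A c' z)))"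
      by (rule smooth_on_compose[OF op \<xi>[unfolded smooth_local_def] smooth_transition_jet[OF c' c]])
        (use c' in auto)
    show "smooth_on (ecoord c' ` (edom A c' \<inter> edom A c)) (vextend c f \<xi> c' \<circ> einv A c')"
      by (rule smooth_on_cong[OF op smooth_on_scaleR[OF op f'
            smooth_on_frechet_derivative_compose[OF op smooth_transition_jet[OF c c']
              smooth_transition_jet[OF c' c] im x]]])
        (use c c' in \<open>auto simp: vextend_def dtrans_def comp_def\<close>)
  qed
  next
    fix c' c'' q
    assume c': "c' \<in> echarts A" "c'' \<in> echarts A" "q \<in> edom A c'" "q \<in> edom A c''"
    have lin: "linear (dtrans A c' c'' q)" using c' linear_dtrans by blast
    show "vextend c f \<xi> c'' q = dtrans A c' c'' q (vextend c f \<xi> c' q)"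
    proof (cases "q \<in> edom A c")
      case True
      then have "dtrans A c' c'' q (dtrans A c c' q (\<xi> q)) = dtrans A c c'' q (\<xi> q)"
        using c c' dtrans_trans by blast
      then show ?thesis using True c' by (simp add: vextend_def linear_scale[OF lin])
    qed (use c' in \<open>simp add: vextend_def linear_0[OF lin]\<close>)
  qed (auto simp: vextend_def)
qed

lemma smooth_local_scaleR:
  "c \<in> echarts A \<Longrightarrow> smooth_local A c f \<Longrightarrow> smooth_local A c g \<Longrightarrow>
    smooth_local A c (\<lambda>p. f p *\<^sub>R g p)"
  using smooth_on_scaleR[OF open_ecoord] by (simp add: smooth_local_def comp_def)

lemma smooth_local_mult:
  fixes f g :: "'m jet \<Rightarrow> real"
  shows "c \<in> echarts A \<Longrightarrow> smooth_local A c f \<Longrightarrow> smooth_local A c g \<Longrightarrow>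
    smooth_local A c (\<lambda>p. f p * g p)"
  using smooth_on_mult[OF open_ecoord] by (simp add: smooth_local_def comp_def)

lemma smooth_local_add:
  "c \<in> echarts A \<Longrightarrow> smooth_local A c f \<Longrightarrow> smooth_local A c g \<Longrightarrow>
    smooth_local A c (\<lambda>p. f p + g p)"
  using smooth_on_add[OF open_ecoord] by (simp add: smooth_local_def comp_def)

lemma smooth_local_diff:
  "c \<in> echarts A \<Longrightarrow> smooth_local A c f \<Longrightarrow> smooth_local A c g \<Longrightarrow>
    smooth_local A c (\<lambda>p. f p - g p)"
  using smooth_on_diff[OF open_ecoord] by (simp add: smooth_local_def comp_def)

lemma smooth_local_sum:
  "c \<in> echarts A \<Longrightarrow> (\<And>i. i \<in> N \<Longrightarrow> smooth_local A c (f i)) \<Longrightarrow>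
    smooth_local A c (\<lambda>p. \<Sum>i\<in>N. f i p)"
  unfolding smooth_local_def comp_def by (rule smooth_on_sum[OF open_ecoord])

lemma smooth_local_linear:
  "c \<in> echarts A \<Longrightarrow> bounded_linear l \<Longrightarrow> smooth_local A c f \<Longrightarrow> smooth_local A c (\<lambda>p. l (f p))"
  using smooth_on_linear_comp[OF open_ecoord] by (simp add: smooth_local_def comp_def)

lemma smooth_local_const [simp]: "smooth_local A c (\<lambda>p. a)"
  by (simp add: smooth_local_def comp_def)

lemma smooth_local_cong:
  assumes "c \<in> echarts A" "smooth_local A c f" "\<And>p. p \<in> edom A c \<Longrightarrow> f p = g p"
  shows "smooth_local A c g"
  unfolding smooth_local_def
  by (rule smooth_on_cong[OF open_ecoord[OF assms(1)] assms(2)[unfolded smooth_local_def]])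
    (use assms in auto)

lemma smooth_fun_mult:
  "smooth_fun A f \<Longrightarrow> smooth_fun A g \<Longrightarrow> smooth_fun A (\<lambda>p. f p * g p)"
  by (simp add: smooth_fun_def smooth_local_mult)

lemma vadd_in_vfields:
  assumes X: "X \<in> vfields A" and Y: "Y \<in> vfields A"
  shows "vadd X Y \<in> vfields A"
proof (rule vfieldsI)
  show "smooth_local A c (vadd X Y c)" if "c \<in> echarts A" for c
    unfolding vadd_def using that X Y by (intro smooth_local_add vfields_smooth)
  show "vadd X Y c' p = dtrans A c c' p (vadd X Y c p)"
    if *: "c \<in> echarts A" "c' \<in> echarts A" "p \<in> edom A c" "p \<in> edom A c'" for c c' p
    unfolding vadd_def linear_add[OF linear_dtrans[OF *]] vfields_trans[OF X *] vfields_trans[OF Y *] ..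
qed (simp add: vadd_def vfields_zero[OF X] vfields_zero[OF Y])

lemma vscale_in_vfields:
  assumes f: "smooth_fun A f" and X: "X \<in> vfields A"
  shows "vscale f X \<in> vfields A"
proof (rule vfieldsI)
  show "smooth_local A c (vscale f X c)" if "c \<in> echarts A" for c
    unfolding vscale_def using that X f by (intro smooth_local_scaleR vfields_smooth) (auto simp: smooth_fun_def)
  show "vscale f X c' p = dtrans A c c' p (vscale f X c p)"
    if *: "c \<in> echarts A" "c' \<in> echarts A" "p \<in> edom A c" "p \<in> edom A c'" for c c' p
    unfolding vscale_def linear_scale[OF linear_dtrans[OF *]] vfields_trans[OF X *] ..
qed (simp add: vscale_def vfields_zero[OF X])

lemma vfields_extend:
  assumes "c \<in> echarts A" "p \<in> edom A c" "smooth_local A c \<xi>"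
  obtains X W where "X \<in> vfields A" "jet_open A W" "p \<in> W" "W \<subseteq> edom A c" "\<And>q. q \<in> W \<Longrightarrow> X c q = \<xi> q"
proof -
  obtain f W where "cutoff c (edom A c) f" "jet_open A W" "p \<in> W" "W \<subseteq> edom A c"
    and f: "\<And>q. q \<in> W \<Longrightarrow> f q = 1"
    using exists_cutoff[OF assms(1,2,2) jet_open_edom[OF assms(1)]] by blast
  then show thesis
    using that[OF vextend_in_vfields[OF assms(1) _ assms(3)]] vextend_chart[OF assms(1)]
    by (simp add: subset_iff)
qed

text \<open>This turns agreement on an open set into an identity of global fields, the only kind of identity
  to which the axioms of a connection apply.\<close>

lemma vscale_cutoff_eq:
  assumes c: "c \<in> echarts A" and f: "cutoff c W f" and XY: "X \<in> vfields A" "Y \<in> vfields A"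
    and eq: "\<And>q. q \<in> W \<inter> edom A c \<Longrightarrow> X c q = Y c q"
  shows "vscale f X = vscale f Y"
proof (intro ext)
  fix c' q
  show "vscale f X c' q = vscale f Y c' q"
  proof (cases "c' \<in> echarts A \<and> q \<in> edom A c' \<and> f q \<noteq> 0")
    case True
    then have "q \<in> W \<inter> edom A c" using cutoffD[OF f] by blast
    then show ?thesis
      using eq vfields_trans[OF XY(1) c, of c' q] vfields_trans[OF XY(2) c, of c' q] True
      by (simp add: vscale_def)
  qed (use vfields_zero[OF XY(1), of c' q] vfields_zero[OF XY(2), of c' q] in \<open>auto simp: vscale_def\<close>)
qed

end

section \<open>The adapted frame and its projections\<close>

text \<open>The index \<open>Inl ()\<close> stands for the time direction, \<open>Inr (Inl i)\<close> for the
  \<open>i\<close>-th horizontal and \<open>Inr (Inr i)\<close> for the \<open>i\<close>-th vertical direction.\<close>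

type_synonym 'n direction = "unit + 'n + 'n"

definition frame :: "('m, 'n::finite) nlconn \<Rightarrow> ('m, 'n) echart \<Rightarrow> 'n direction \<Rightarrow> 'm jet \<Rightarrow> 'n coords" where
  "frame \<Gamma> c a p = (case a of Inl _ \<Rightarrow> \<delta>t \<Gamma> c p | Inr (Inl i) \<Rightarrow> \<delta>x \<Gamma> c i p | Inr (Inr i) \<Rightarrow> dely i p)"

text \<open>The dual coframe: \<open>dt\<close>, \<open>dx\<^sup>i\<close> and \<open>\<delta>y\<^sup>i = dy\<^sup>i + M\<^sup>i dt + N\<^sup>i\<^sub>j dx\<^sup>j\<close>.\<close>

definition coframe :: "('m, 'n::finite) nlconn \<Rightarrow> ('m, 'n) echart \<Rightarrow> 'm jet \<Rightarrow> 'n coords \<Rightarrow> 'n direction \<Rightarrow> real" where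
  "coframe \<Gamma> c p w a = (case a of Inl _ \<Rightarrow> fst w | Inr (Inl i) \<Rightarrow> fst (snd w) $ i
     | Inr (Inr i) \<Rightarrow> snd (snd w) $ i + fst \<Gamma> c p $ i * fst w + (\<Sum>j\<in>UNIV. snd \<Gamma> c p $ i $ j * fst (snd w) $ j))"

definition time_dir :: "'n direction set" where "time_dir = {Inl ()}"
definition base_dirs :: "'n direction set" where "base_dirs = range (\<lambda>i. Inr (Inl i))"
definition fibre_dirs :: "'n direction set" where "fibre_dirs = range (\<lambda>i. Inr (Inr i))"

lemma sum_scaleR_axis: "(\<Sum>j\<in>UNIV. (a $ j) *\<^sub>R axis j 1) = (a :: real^'n::finite)"
  using basis_expansion[of a] by (simp add: scalar_mult_eq_scaleR)

lemma sum_ddy: "(\<Sum>j\<in>UNIV. (a $ j) *\<^sub>R ddy j) = (0, 0, a :: real^'n::finite)"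
proof -
  have "(\<Sum>j\<in>UNIV. (a $ j) *\<^sub>R ddy j) = (\<Sum>j\<in>UNIV. (0, 0, (a $ j) *\<^sub>R axis j 1))"
    by (simp add: ddy_def)
  also have "\<dots> = (0, 0, \<Sum>j\<in>UNIV. (a $ j) *\<^sub>R axis j 1)"
    by (simp add: prod_eq_iff fst_sum snd_sum)
  finally show ?thesis by (simp add: sum_scaleR_axis)
qed

lemma \<delta>t_eq: "\<delta>t \<Gamma> c p = (1, 0, - fst \<Gamma> c p)"
  by (simp add: \<delta>t_def sum_ddy ddt_def)

lemma \<delta>x_eq: "\<delta>x \<Gamma> c i p = (0, axis i 1, - column i (snd \<Gamma> c p))"
  using sum_ddy[of "column i (snd \<Gamma> c p)"] by (simp add: \<delta>x_def ddx_def column_def)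

lemma frame_simps [simp]:
  "frame \<Gamma> c (Inl u) = \<delta>t \<Gamma> c"
  "frame \<Gamma> c (Inr (Inl i)) = \<delta>x \<Gamma> c i"
  "frame \<Gamma> c (Inr (Inr i)) = dely i"
  by (auto simp: frame_def)

lemma sum_direction:
  fixes f :: "'n::finite direction \<Rightarrow> 'b::comm_monoid_add"
  shows "(\<Sum>a\<in>UNIV. f a) = f (Inl ()) + ((\<Sum>i\<in>UNIV. f (Inr (Inl i))) + (\<Sum>i\<in>UNIV. f (Inr (Inr i))))"
  by (simp add: UNIV_Plus_UNIV[symmetric] sum.Plus UNIV_unit del: UNIV_Plus_UNIV)

lemma coframe_add: "coframe \<Gamma> c p (v + w) b = coframe \<Gamma> c p v b + coframe \<Gamma> c p w b"
  by (auto simp: coframe_def algebra_simps sum.distrib split: sum.splits)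

lemma coframe_0: "coframe \<Gamma> c p 0 b = 0"
  by (auto simp: coframe_def split: sum.splits)

lemma coframe_sum: "coframe \<Gamma> c p (\<Sum>a\<in>B. f a) b = (\<Sum>a\<in>B. coframe \<Gamma> c p (f a) b)"
  by (induction B rule: infinite_finite_induct) (simp_all add: coframe_add coframe_0)

lemma coframe_scaleR: "coframe \<Gamma> c p (r *\<^sub>R w) b = r * coframe \<Gamma> c p w b"
  by (auto simp: coframe_def algebra_simps sum_distrib_left split: sum.splits)

lemma coframe_frame: "coframe \<Gamma> c p (frame \<Gamma> c a p) b = (if a = b then 1 else 0)"
  by (auto simp: coframe_def frame_def \<delta>t_eq \<delta>x_eq dely_def ddy_def column_def axis_def
      if_distrib[of "\<lambda>x. _ * x"] cong: if_cong split: sum.splits)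

lemma coframe_combination:
  "coframe \<Gamma> c p (\<Sum>a\<in>B. r a *\<^sub>R frame \<Gamma> c a p) b = (if b \<in> B then r b else 0)"
  for B :: "'n::finite direction set"
  by (simp add: coframe_sum coframe_scaleR coframe_frame if_distrib[of "\<lambda>x. _ * x"] cong: if_cong)

lemma frame_expansion: "(\<Sum>a\<in>UNIV. coframe \<Gamma> c p w a *\<^sub>R frame \<Gamma> c a p) = w"
proof -
  have x: "(\<Sum>i\<in>UNIV. x $ i *\<^sub>R \<delta>x \<Gamma> c i p) =
      (0, x, - (\<Sum>i\<in>UNIV. x $ i *\<^sub>R column i (snd \<Gamma> c p)))" for x
    by (simp add: \<delta>x_eq prod_eq_iff fst_sum snd_sum sum_scaleR_axis sum_negf)
  have y: "(\<Sum>i\<in>UNIV. y i *\<^sub>R dely i p) = (0, 0, \<chi> i. y i)" for y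
    using sum_ddy[of "\<chi> i. y i"] by (simp add: dely_def)
  show ?thesis
    unfolding sum_direction
    by (simp add: coframe_def x y \<delta>t_eq) (simp add: prod_eq_iff vec_eq_iff column_def algebra_simps)
qed

text \<open>The span of a part of the frame is the common kernel of the remaining coframe elements, so
  membership in it can be tested by coefficients.\<close>

lemma span_frame:
  fixes B :: "'n::finite direction set"
  shows "span ((\<lambda>a. frame \<Gamma> c a p) ` B) = {w. \<forall>b. b \<notin> B \<longrightarrow> coframe \<Gamma> c p w b = 0}"
proof (intro equalityI subsetI)
  fix w assume "w \<in> span ((\<lambda>a. frame \<Gamma> c a p) ` B)"
  then show "w \<in> {w. \<forall>b. b \<notin> B \<longrightarrow> coframe \<Gamma> c p w b = 0}"
  proof (induction rule: span_induct_alt)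
    case base
    then show ?case by (simp add: coframe_0)
  next
    case (step r v w)
    then show ?case by (auto simp: coframe_add coframe_scaleR coframe_frame split: if_splits)
  qed
next
  fix w assume "w \<in> {w. \<forall>b. b \<notin> B \<longrightarrow> coframe \<Gamma> c p w b = 0}"
  then have "w = (\<Sum>a\<in>B. coframe \<Gamma> c p w a *\<^sub>R frame \<Gamma> c a p)"
    using frame_expansion[of \<Gamma> c p w] by (subst sum.mono_neutral_left[of UNIV]) auto
  also have "\<dots> \<in> span ((\<lambda>a. frame \<Gamma> c a p) ` B)"
    by (intro span_sum span_scale span_base) auto
  finally show "w \<in> span ((\<lambda>a. frame \<Gamma> c a p) ` B)" .
qed

lemma proj_along_frame:
  fixes B :: "'n::finite direction set"
  shows "proj_along ((\<lambda>a. frame \<Gamma> c a p) ` B) ((\<lambda>a. frame \<Gamma> c a p) ` (- B)) w =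
    (\<Sum>a\<in>B. coframe \<Gamma> c p w a *\<^sub>R frame \<Gamma> c a p)" (is "_ = ?h")
  unfolding proj_along_def
proof (rule the_equality)
  have diff: "coframe \<Gamma> c p (v - u) b = coframe \<Gamma> c p v b - coframe \<Gamma> c p u b" for u v b
    by (auto simp: coframe_def algebra_simps sum_subtractf split: sum.splits)
  show "?h \<in> span ((\<lambda>a. frame \<Gamma> c a p) ` B) \<and> w - ?h \<in> span ((\<lambda>a. frame \<Gamma> c a p) ` (- B))"
    by (simp add: span_frame diff coframe_combination)
  fix u
  assume "u \<in> span ((\<lambda>a. frame \<Gamma> c a p) ` B) \<and> w - u \<in> span ((\<lambda>a. frame \<Gamma> c a p) ` (- B))"
  then have u: "b \<notin> B \<Longrightarrow> coframe \<Gamma> c p u b = 0" "b \<in> B \<Longrightarrow> coframe \<Gamma> c p u b = coframe \<Gamma> c p w b" for b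
    by (auto simp: span_frame diff)
  have "u = (\<Sum>a\<in>B. coframe \<Gamma> c p u a *\<^sub>R frame \<Gamma> c a p)"
    using frame_expansion[of \<Gamma> c p u] u(1) by (subst sum.mono_neutral_left[of UNIV]) auto
  also have "\<dots> = ?h" using u(2) by (intro sum.cong) auto
  finally show "u = ?h" .
qed

text \<open>The projection onto a part of the frame along the rest, written by coefficients so that its smoothness
  is visible.\<close>

definition block_proj ::
  "'n direction set \<Rightarrow> ('m, 'n::finite) nlconn \<Rightarrow> ('m, 'n) vfield \<Rightarrow> ('m, 'n) vfield" where
  "block_proj B \<Gamma> X = (\<lambda>c p. \<Sum>a\<in>B. coframe \<Gamma> c p (X c p) a *\<^sub>R frame \<Gamma> c a p)"

lemma direction_blocks:
  "- time_dir = base_dirs \<union> fibre_dirs"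
  "- base_dirs = time_dir \<union> fibre_dirs"
  "- fibre_dirs = time_dir \<union> base_dirs"
proof -
  have "a \<in> time_dir \<union> base_dirs \<union> fibre_dirs" for a :: "'n direction"
    by (cases a; cases "projr a") (auto simp: time_dir_def base_dirs_def fibre_dirs_def)
  then show "- time_dir = base_dirs \<union> (fibre_dirs :: 'n direction set)"
    "- base_dirs = time_dir \<union> (fibre_dirs :: 'n direction set)"
    "- fibre_dirs = time_dir \<union> (base_dirs :: 'n direction set)"
    by (fastforce simp: time_dir_def base_dirs_def fibre_dirs_def)+
qed

lemma frame_image_dirs:
  "(\<lambda>a. frame \<Gamma> c a p) ` time_dir = {\<delta>t \<Gamma> c p}"
  "(\<lambda>a. frame \<Gamma> c a p) ` base_dirs = range (\<lambda>i. \<delta>x \<Gamma> c i p)"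
  "(\<lambda>a. frame \<Gamma> c a p) ` fibre_dirs = range (\<lambda>i. dely i p)"
  by (simp_all add: time_dir_def base_dirs_def fibre_dirs_def image_image)

lemma adapted_projections:
  "h\<^sub>R \<Gamma> = block_proj time_dir \<Gamma>"
  "h\<^sub>M \<Gamma> = block_proj base_dirs \<Gamma>"
  "vproj \<Gamma> = block_proj fibre_dirs \<Gamma>"
  unfolding h\<^sub>R_def h\<^sub>M_def vproj_def block_proj_def proj_along_frame[symmetric]
    direction_blocks image_Un frame_image_dirs
  by (rule refl)+

lemma block_proj_frame:
  assumes "X c p = frame \<Gamma> c b p" "b \<in> B"
  shows "block_proj B \<Gamma> X c p = X c p"
  using assms unfolding block_proj_def
  by (simp add: coframe_frame if_distrib[of "\<lambda>x. x *\<^sub>R _"] cong: if_cong)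

lemma linear_vec_expansion:
  fixes f :: "real^'n::finite \<Rightarrow> real^'k::finite"
  assumes "linear f"
  shows "f v $ l = (\<Sum>j\<in>UNIV. v $ j * f (axis j 1) $ l)"
proof -
  have "f v = f (\<Sum>j\<in>UNIV. (v $ j) *\<^sub>R axis j 1)" by (simp add: sum_scaleR_axis)
  also have "\<dots> = (\<Sum>j\<in>UNIV. (v $ j) *\<^sub>R f (axis j 1))"
    by (simp add: linear_sum[OF assms] linear_scale[OF assms])
  finally show ?thesis by simp
qed

definition adapted_block :: "'n direction set \<Rightarrow> bool" where
  "adapted_block B \<longleftrightarrow> B \<in> {time_dir, base_dirs, fibre_dirs}"

locale jet_nonlinear_connection = jet_space M A for M :: "'m topology" and A :: "('m, 'n::finite) mchart set" +
  fixes \<Gamma> :: "('m, 'n) nlconn"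
  assumes nonlinear: "nonlinear_connection A \<Gamma>"
begin

lemma smooth_nonlinear:
  assumes "c \<in> echarts A"
  shows "smooth_local A c (\<lambda>p. fst \<Gamma> c p $ i)" "smooth_local A c (\<lambda>p. snd \<Gamma> c p $ i $ j)"
proof -
  have *: "smooth_local A c (fst \<Gamma> c)" "smooth_local A c (snd \<Gamma> c)"
    using nonlinear assms unfolding nonlinear_connection_def by blast+
  show "smooth_local A c (\<lambda>p. fst \<Gamma> c p $ i)"
    by (rule smooth_local_linear[OF assms bounded_linear_vec_nth *(1)])
  show "smooth_local A c (\<lambda>p. snd \<Gamma> c p $ i $ j)"
    by (rule smooth_local_linear[OF assms bounded_linear_vec_nth
          smooth_local_linear[OF assms bounded_linear_vec_nth *(2)]])
qed

lemma smooth_frame: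
  assumes "c \<in> echarts A"
  shows "smooth_local A c (frame \<Gamma> c a)"
proof -
  have "smooth_local A c (\<delta>t \<Gamma> c)"
    unfolding \<delta>t_def[abs_def]
    by (intro smooth_local_diff smooth_local_sum smooth_local_scaleR smooth_nonlinear
        smooth_local_const assms)
  moreover have "smooth_local A c (\<delta>x \<Gamma> c i)" for i
    unfolding \<delta>x_def[abs_def]
    by (intro smooth_local_diff smooth_local_sum smooth_local_scaleR smooth_nonlinear
        smooth_local_const assms)
  moreover have "smooth_local A c (dely i)" for i
    unfolding dely_def[abs_def] by simp
  ultimately show ?thesis
    by (cases a; cases "projr a") auto
qed

lemma smooth_coframe:
  assumes c: "c \<in> echarts A" and \<xi>: "smooth_local A c \<xi>"
  shows "smooth_local A c (\<lambda>p. coframe \<Gamma> c p (\<xi> p) a)"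
proof -
  have t: "smooth_local A c (\<lambda>p. fst (\<xi> p))"
    by (rule smooth_local_linear[OF c bounded_linear_fst \<xi>])
  have x: "smooth_local A c (\<lambda>p. fst (snd (\<xi> p)) $ i)" for i
    by (intro smooth_local_linear[OF c bounded_linear_vec_nth]
        smooth_local_linear[OF c bounded_linear_fst] smooth_local_linear[OF c bounded_linear_snd] \<xi>)
  have y: "smooth_local A c (\<lambda>p. snd (snd (\<xi> p)) $ i)" for i
    by (intro smooth_local_linear[OF c bounded_linear_vec_nth]
        smooth_local_linear[OF c bounded_linear_snd] \<xi>)
  have "smooth_local A c (\<lambda>p. snd (snd (\<xi> p)) $ i + fst \<Gamma> c p $ i * fst (\<xi> p)
      + (\<Sum>j\<in>UNIV. snd \<Gamma> c p $ i $ j * fst (snd (\<xi> p)) $ j))" for i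
    by (intro smooth_local_add smooth_local_sum smooth_local_mult smooth_nonlinear c t x y)
  then show ?thesis
    using t x by (cases a; cases "projr a") (auto simp: coframe_def)
qed

text \<open>This is what the transformation rule of a nonlinear connection is made for: a coordinate
  change maps each of the three parts of the adapted frame into the span of the corresponding part.\<close>

lemma dtrans_frame:
  assumes c: "c \<in> echarts A" "c' \<in> echarts A" and p: "p \<in> edom A c" "p \<in> edom A c'"
    and B: "adapted_block B" and ab: "(a \<in> B) \<noteq> (b \<in> B)"
  shows "coframe \<Gamma> c' p (dtrans A c c' p (frame \<Gamma> c a p)) b = 0"
proof -
  let ?D = "dtrans A c c' p" and ?D' = "dtrans A c' c p"
  obtain k J where kJ: "k \<noteq> 0" "linear J" "\<And>w. fst (?D w) = inverse k * fst w"
    "\<And>w. fst (snd (?D w)) = J (fst (snd w))" "\<And>y. ?D (0, 0, y) = (0, 0, k *\<^sub>R J y)"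
    using dtrans_blocks[OF c p] by blast
  obtain k' J' where kJ': "k' \<noteq> 0" "linear J'" "\<And>w. fst (?D' w) = inverse k' * fst w"
    "\<And>w. fst (snd (?D' w)) = J' (fst (snd w))"
    using dtrans_blocks[OF c(2,1) p(2,1)] by metis
  have inv: "?D' (?D w) = w" for w
    using dtrans_trans[OF c c(1) p p(1)] dtrans_refl[OF c(1) p(1)] by simp
  have k': "inverse k' = k"
    using inv[of ddt] kJ(3)[of ddt] kJ'(3)[of "?D ddt"] kJ(1) kJ'(1) by (simp add: ddt_def field_simps)
  have J': "J' (J x) = x" for x
    using inv[of "(0, x, 0)"] kJ(4)[of "(0, x, 0)"] kJ'(4)[of "?D (0, x, 0)"] by simp
  note lin = linear_diff[OF linear_dtrans[OF c p]]
  have MN: "fst \<Gamma> c' p $ l = (\<Sum>j\<in>UNIV. fst \<Gamma> c p $ j * k\<^sup>2 * J (axis j 1) $ l) - k * snd (snd (?D ddt)) $ l"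
    "snd \<Gamma> c' p $ l $ m =
      (\<Sum>i\<in>UNIV. \<Sum>j\<in>UNIV. snd \<Gamma> c p $ j $ i * k * J' (axis m 1) $ i * J (axis j 1) $ l)
      - (\<Sum>i\<in>UNIV. J' (axis m 1) $ i * snd (snd (?D (ddx i))) $ l)" for l m
    using nonlinear c p kJ(4) kJ'(3,4) unfolding nonlinear_connection_def Let_def
    by (simp_all add: k' ddt_def ddx_def)
  have t: "?D (\<delta>t \<Gamma> c p) = ?D ddt - (0, 0, k *\<^sub>R J (fst \<Gamma> c p))"
    using lin[of ddt "(0, 0, fst \<Gamma> c p)"] kJ(5) by (simp add: \<delta>t_eq ddt_def)
  have x: "?D (\<delta>x \<Gamma> c i p) = ?D (ddx i) - (0, 0, k *\<^sub>R J (column i (snd \<Gamma> c p)))" for i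
    using lin[of "ddx i" "(0, 0, column i (snd \<Gamma> c p))"] kJ(5) by (simp add: \<delta>x_eq ddx_def)
  have ty: "coframe \<Gamma> c' p (?D (\<delta>t \<Gamma> c p)) (Inr (Inr l)) = 0" for l
  proof -
    have "(\<Sum>j\<in>UNIV. fst \<Gamma> c p $ j * k\<^sup>2 * J (axis j 1) $ l) = k\<^sup>2 * J (fst \<Gamma> c p) $ l"
      unfolding linear_vec_expansion[OF kJ(2), of "fst \<Gamma> c p"]
      by (simp add: sum_distrib_left mult_ac)
    moreover have fD: "fst (?D ddt) = inverse k" "fst (snd (?D ddt)) = 0"
      using linear_0[OF kJ(2)] by (simp_all add: kJ ddt_def)
    ultimately show ?thesis
      using kJ(1) by (simp add: coframe_def t MN fD left_diff_distrib power2_eq_square)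
        (simp add: field_simps)
  qed
  have xy: "coframe \<Gamma> c' p (?D (\<delta>x \<Gamma> c i p)) (Inr (Inr l)) = 0" for i l
  proof -
    let ?N = "snd \<Gamma> c p" and ?e = "J (axis i 1)"
    \<comment> \<open>The Jacobians of the change of base coordinates and of its inverse are inverse matrices.\<close>
    have \<delta>: "(\<Sum>m\<in>UNIV. ?e $ m * J' (axis m 1) $ r) = (if r = i then 1 else 0)" for r
      using linear_vec_expansion[OF kJ'(2), of ?e r] J'[of "axis i 1"] by (simp add: axis_def)
    have "(\<Sum>m\<in>UNIV. snd \<Gamma> c' p $ l $ m * ?e $ m) =
      (\<Sum>m\<in>UNIV. \<Sum>r\<in>UNIV. (?e $ m * J' (axis m 1) $ r) *
        ((\<Sum>j\<in>UNIV. ?N $ j $ r * k * J (axis j 1) $ l) - snd (snd (?D (ddx r))) $ l))"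
      by (simp add: MN algebra_simps sum_distrib_left sum_distrib_right sum_subtractf)
    also have "\<dots> = (\<Sum>r\<in>UNIV. (\<Sum>m\<in>UNIV. ?e $ m * J' (axis m 1) $ r) *
        ((\<Sum>j\<in>UNIV. ?N $ j $ r * k * J (axis j 1) $ l) - snd (snd (?D (ddx r))) $ l))"
      by (subst sum.swap) (simp add: sum_distrib_right)
    also have "\<dots> = (\<Sum>j\<in>UNIV. ?N $ j $ i * k * J (axis j 1) $ l) - snd (snd (?D (ddx i))) $ l"
      by (simp add: \<delta> if_distrib[of "\<lambda>x. x * _"] cong: if_cong)
    also have "(\<Sum>j\<in>UNIV. ?N $ j $ i * k * J (axis j 1) $ l) = k * J (column i ?N) $ l"
      unfolding linear_vec_expansion[OF kJ(2), of "column i ?N"]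
      by (simp add: sum_distrib_left column_def mult_ac)
    finally show ?thesis
      using kJ(3)[of "ddx i"] kJ(4)[of "ddx i"]
      by (simp add: coframe_def x ddx_def)
  qed
  have 0: "fst (?D (\<delta>x \<Gamma> c i p)) = 0" "fst (?D (dely i p)) = 0" "fst (snd (?D (dely i p))) = 0"
    "fst (snd (?D (\<delta>t \<Gamma> c p))) = 0" for i
    using linear_0[OF kJ(2)] by (simp_all add: kJ \<delta>x_eq \<delta>t_eq dely_def ddy_def)
  have "coframe \<Gamma> c' p (?D (\<delta>t \<Gamma> c p)) (Inr (Inl l)) = 0"
    "coframe \<Gamma> c' p (?D (\<delta>x \<Gamma> c i p)) (Inl u) = 0"
    "coframe \<Gamma> c' p (?D (dely i p)) (Inl u) = 0"
    "coframe \<Gamma> c' p (?D (dely i p)) (Inr (Inl l)) = 0" for l i u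
    by (simp_all add: coframe_def 0)
  with ty xy show ?thesis
    using B ab by (cases a; cases "projr a"; cases b; cases "projr b")
      (auto simp: adapted_block_def time_dir_def base_dirs_def fibre_dirs_def)
qed

text \<open>A coordinate change respects a part of the frame and also the complementary part, so it intertwines
  the projections.\<close>

lemma dtrans_block_proj:
  assumes c: "c \<in> echarts A" "c' \<in> echarts A" and p: "p \<in> edom A c" "p \<in> edom A c'"
    and B: "adapted_block B"
  shows "(\<Sum>b\<in>B. coframe \<Gamma> c' p (dtrans A c c' p w) b *\<^sub>R frame \<Gamma> c' b p) =
    dtrans A c c' p (\<Sum>a\<in>B. coframe \<Gamma> c p w a *\<^sub>R frame \<Gamma> c a p)"
proof -
  let ?D = "dtrans A c c' p"
  let ?h = "\<lambda>B. \<Sum>a\<in>B. coframe \<Gamma> c p w a *\<^sub>R frame \<Gamma> c a p"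
  note lin = linear_dtrans[OF c p]
  have D: "?D (?h B') = (\<Sum>a\<in>B'. coframe \<Gamma> c p w a *\<^sub>R ?D (frame \<Gamma> c a p))" for B'
    by (simp add: linear_sum[OF lin] linear_scale[OF lin])
  have in_B: "coframe \<Gamma> c' p (?D w) b = coframe \<Gamma> c' p (?D (?h B)) b" if "b \<in> B" for b
  proof -
    have "?D w = ?D (?h UNIV)" by (simp add: frame_expansion)
    also have "coframe \<Gamma> c' p \<dots> b = coframe \<Gamma> c' p (?D (?h B)) b"
      unfolding D coframe_sum coframe_scaleR
      by (rule sum.mono_neutral_right) (use dtrans_frame[OF c p B] that in auto)
    finally show ?thesis .
  qed
  have "coframe \<Gamma> c' p (?D (?h B)) b = 0" if "b \<notin> B" for b
    unfolding D coframe_sum coframe_scaleR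
    using dtrans_frame[OF c p B] that by (intro sum.neutral) auto
  then have "?D (?h B) = (\<Sum>b\<in>B. coframe \<Gamma> c' p (?D (?h B)) b *\<^sub>R frame \<Gamma> c' b p)"
    using frame_expansion[of \<Gamma> c' p "?D (?h B)"] by (subst sum.mono_neutral_left[of UNIV]) auto
  then show ?thesis using in_B by (metis (no_types, lifting) sum.cong)
qed

text \<open>The compatibility of a connection with the projections speaks about \<open>\<nabla>\<^sub>X (h Y)\<close>. Locality
  of the connection can be applied to this expression only if \<open>h Y\<close> is itself a smooth global field.\<close>

lemma block_proj_in_vfields:
  assumes X: "X \<in> vfields A" and B: "adapted_block B"
  shows "block_proj B \<Gamma> X \<in> vfields A"
proof (rule vfieldsI)
  show "smooth_local A c (block_proj B \<Gamma> X c)" if "c \<in> echarts A" for c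
    unfolding block_proj_def
    by (intro smooth_local_sum smooth_local_scaleR smooth_frame smooth_coframe vfields_smooth X that)
  show "block_proj B \<Gamma> X c' p = dtrans A c c' p (block_proj B \<Gamma> X c p)"
    if *: "c \<in> echarts A" "c' \<in> echarts A" "p \<in> edom A c" "p \<in> edom A c'" for c c' p
    unfolding block_proj_def vfields_trans[OF X *] by (rule dtrans_block_proj[OF * B])
  show "block_proj B \<Gamma> X c p = 0" if "\<not> (c \<in> echarts A \<and> p \<in> edom A c)" for c p
  proof -
    show ?thesis using vfields_zero[OF X that] by (simp add: block_proj_def coframe_0)
  qed
qed

end

section \<open>Locality of linear connections\<close>

lemma linear_connectionD:
  assumes "linear_connection A D"
  shows "X \<in> vfields A \<Longrightarrow> Y \<in> vfields A \<Longrightarrow> D X Y \<in> vfields A"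
    and "X \<in> vfields A \<Longrightarrow> X' \<in> vfields A \<Longrightarrow> Y \<in> vfields A \<Longrightarrow> D (vadd X X') Y = vadd (D X Y) (D X' Y)"
    and "smooth_fun A f \<Longrightarrow> X \<in> vfields A \<Longrightarrow> Y \<in> vfields A \<Longrightarrow> D (vscale f X) Y = vscale f (D X Y)"
    and "X \<in> vfields A \<Longrightarrow> Y \<in> vfields A \<Longrightarrow> Y' \<in> vfields A \<Longrightarrow> D X (vadd Y Y') = vadd (D X Y) (D X Y')"
    and "smooth_fun A f \<Longrightarrow> X \<in> vfields A \<Longrightarrow> Y \<in> vfields A \<Longrightarrow>
      D X (vscale f Y) = (\<lambda>c p. vapply A X f c p *\<^sub>R Y c p + f p *\<^sub>R D X Y c p)"
  using assms unfolding linear_connection_def by blast+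

context jet_space
begin

text \<open>In the first argument multiplication by a cutoff is harmless by linearity over functions. In the
  second it produces the extra term \<open>X(f) Y\<close>, which involves only the value of \<open>Y\<close> at the point.\<close>

lemma connection_local:
  assumes lin: "linear_connection A D" and c: "c \<in> echarts A" and p: "p \<in> edom A c" "p \<in> S"
    and S: "jet_open A S"
    and XY: "X \<in> vfields A" "X' \<in> vfields A" "Y \<in> vfields A" "Y' \<in> vfields A"
    and eq: "\<And>q. q \<in> S \<inter> edom A c \<Longrightarrow> X c q = X' c q" "\<And>q. q \<in> S \<inter> edom A c \<Longrightarrow> Y c q = Y' c q"
  shows "D X Y c p = D X' Y' c p"
proof -
  obtain f W where f: "cutoff c S f" "p \<in> W" "\<And>q. q \<in> W \<Longrightarrow> f q = 1"
    using exists_cutoff[OF c p S] by metis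
  have sf: "smooth_fun A f" and fp: "f p = 1" using cutoffD(1)[OF f(1)] f(2,3) by auto
  have "vscale f (D X Y) = vscale f (D X' Y)"
    using linear_connectionD(3)[OF lin sf XY(1,3)] linear_connectionD(3)[OF lin sf XY(2,3)]
      vscale_cutoff_eq[OF c f(1) XY(1,2) eq(1)] by simp
  then have "vscale f (D X Y) c p = vscale f (D X' Y) c p" by simp
  then have "D X Y c p = D X' Y c p" by (simp add: vscale_def fp)
  moreover have "D X' (vscale f Y) c p = D X' (vscale f Y') c p"
    by (simp only: vscale_cutoff_eq[OF c f(1) XY(3,4) eq(2)])
  then have "D X' Y c p = D X' Y' c p"
    using eq(2)[of p] p
    unfolding linear_connectionD(5)[OF lin sf XY(2,3)] linear_connectionD(5)[OF lin sf XY(2,4)]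
    by (simp add: fp)
  ultimately show ?thesis by simp
qed

lemma agree_nearE:
  assumes "agree_near A c p X \<xi>" "agree_near A c p Y \<eta>"
  obtains W where "jet_open A W" "p \<in> W" "\<And>q. q \<in> W \<inter> edom A c \<Longrightarrow> X c q = \<xi> q"
    "\<And>q. q \<in> W \<inter> edom A c \<Longrightarrow> Y c q = \<eta> q"
proof -
  obtain V W where "jet_open A V" "p \<in> V" "\<forall>q \<in> V \<inter> edom A c. X c q = \<xi> q"
    "jet_open A W" "p \<in> W" "\<forall>q \<in> W \<inter> edom A c. Y c q = \<eta> q"
    using assms unfolding agree_near_def by blast
  then show thesis using that[OF jet_open_Int[of V W]] by blast
qed

text \<open>Locality makes the definite description in \<open>local_conn\<close> independent of the chosen extensions.\<close>

lemma local_conn_eq: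
  assumes lin: "linear_connection A D" and c: "c \<in> echarts A" and p: "p \<in> edom A c"
    and XY: "X \<in> vfields A" "Y \<in> vfields A" "agree_near A c p X \<xi>" "agree_near A c p Y \<eta>"
  shows "local_conn A D c \<xi> \<eta> p = D X Y c p"
  unfolding local_conn_def
proof (rule the_equality)
  show "\<forall>X'\<in>vfields A. \<forall>Y'\<in>vfields A. agree_near A c p X' \<xi> \<longrightarrow> agree_near A c p Y' \<eta> \<longrightarrow>
      D X' Y' c p = D X Y c p"
  proof (intro ballI impI)
    fix X' Y' assume X'Y': "X' \<in> vfields A" "Y' \<in> vfields A"
      "agree_near A c p X' \<xi>" "agree_near A c p Y' \<eta>"
    obtain V where V: "jet_open A V" "p \<in> V" "\<And>q. q \<in> V \<inter> edom A c \<Longrightarrow> X c q = \<xi> q"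
      "\<And>q. q \<in> V \<inter> edom A c \<Longrightarrow> Y c q = \<eta> q"
      using agree_nearE[OF XY(3,4)] by blast
    obtain W where W: "jet_open A W" "p \<in> W" "\<And>q. q \<in> W \<inter> edom A c \<Longrightarrow> X' c q = \<xi> q"
      "\<And>q. q \<in> W \<inter> edom A c \<Longrightarrow> Y' c q = \<eta> q"
      using agree_nearE[OF X'Y'(3,4)] by blast
    show "D X' Y' c p = D X Y c p"
      by (rule connection_local[OF lin c p _ jet_open_Int[OF V(1) W(1)] X'Y'(1) XY(1) X'Y'(2) XY(2)])
        (use V W in auto)
  qed
qed (use XY in blast)

lemma exists_agree_near:
  assumes "c \<in> echarts A" "p \<in> edom A c" "smooth_local A c \<xi>"
  obtains X where "X \<in> vfields A" "agree_near A c p X \<xi>"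
proof -
  obtain X W where "X \<in> vfields A" "jet_open A W" "p \<in> W" "\<And>q. q \<in> W \<Longrightarrow> X c q = \<xi> q"
    using vfields_extend[OF assms] by metis
  then show thesis using that[of X] unfolding agree_near_def by blast
qed

text \<open>One pair of global extensions serves for all points near a given one, so near that point the
  induced connection is a component function of a smooth global field.\<close>

lemma smooth_local_conn:
  assumes lin: "linear_connection A D" and c: "c \<in> echarts A"
    and "smooth_local A c \<xi>" "smooth_local A c \<eta>"
  shows "smooth_local A c (local_conn A D c \<xi> \<eta>)"
  unfolding smooth_local_def
proof (rule smooth_on_local)
  fix z assume "z \<in> ecoord c ` edom A c"
  then obtain p where p: "p \<in> edom A c" "z = ecoord c p" by blast
  obtain X where X: "X \<in> vfields A" "agree_near A c p X \<xi>"
    using exists_agree_near[OF c p(1) assms(3)] by blast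
  obtain Y where Y: "Y \<in> vfields A" "agree_near A c p Y \<eta>"
    using exists_agree_near[OF c p(1) assms(4)] by blast
  obtain W where W: "jet_open A W" "p \<in> W" "\<And>q. q \<in> W \<inter> edom A c \<Longrightarrow> X c q = \<xi> q"
    "\<And>q. q \<in> W \<inter> edom A c \<Longrightarrow> Y c q = \<eta> q"
    using agree_nearE[OF X(2) Y(2)] by blast
  let ?T = "ecoord c ` (W \<inter> edom A c)"
  have op: "open ?T" using W(1) c unfolding jet_open_def by blast
  have eq: "local_conn A D c \<xi> \<eta> q = D X Y c q" if "q \<in> W \<inter> edom A c" for q
  proof (rule local_conn_eq[OF lin c _ X(1) Y(1)])
    show "q \<in> edom A c" using that by blast
    show "agree_near A c q X \<xi>" unfolding agree_near_def
      by (intro exI[of _ W] conjI ballI W) (use that in auto)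
    show "agree_near A c q Y \<eta>" unfolding agree_near_def
      by (intro exI[of _ W] conjI ballI W) (use that in auto)
  qed
  have "smooth_on (ecoord c ` edom A c) (D X Y c \<circ> einv A c)"
    using vfields_smooth[OF linear_connectionD(1)[OF lin X(1) Y(1)] c] by (simp add: smooth_local_def)
  then have "smooth_on ?T (D X Y c \<circ> einv A c)" by (rule smooth_on_mono) blast
  then have "smooth_on ?T (local_conn A D c \<xi> \<eta> \<circ> einv A c)"
    by (rule smooth_on_cong[OF op]) (use eq c in auto)
  then show "\<exists>T. open T \<and> z \<in> T \<and> smooth_on T (local_conn A D c \<xi> \<eta> \<circ> einv A c)"
    using op p W(2) by blast
qed

lemma vsum_in_vfields:
  assumes "finite N" "\<And>a. a \<in> N \<Longrightarrow> smooth_fun A (F a)" "\<And>a. a \<in> N \<Longrightarrow> E a \<in> vfields A"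
  shows "(\<lambda>c q. \<Sum>a\<in>N. F a q *\<^sub>R E a c q) \<in> vfields A"
  using assms
proof (induction N rule: finite_induct)
  case empty
  have "linear (dtrans A c c' p)"
    if "c \<in> echarts A" "c' \<in> echarts A" "p \<in> edom A c" "p \<in> edom A c'" for c c' p
    using linear_dtrans that by blast
  then show ?case by (intro vfieldsI) (simp_all add: linear_0)
next
  case (insert a N)
  have "vadd (vscale (F a) (E a)) (\<lambda>c q. \<Sum>a\<in>N. F a q *\<^sub>R E a c q) \<in> vfields A"
    by (intro vadd_in_vfields vscale_in_vfields insert.IH) (use insert.prems in auto)
  then show ?case using insert.hyps by (simp add: vadd_def vscale_def)
qed

end

section \<open>Adapted components\<close>

context jet_nonlinear_connection
begin

text \<open>Multiplied by the square of a cutoff, a field becomes a combination of global fields that extend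
  the adapted frame, with globally smooth coefficients. An expression linear over the smooth functions
  is therefore determined at a point by its values on extensions of the frame.\<close>

lemma tensorial_eq_0:
  assumes c: "c \<in> echarts A" and p: "p \<in> edom A c" and X: "X \<in> vfields A"
    and add: "\<And>X Y. X \<in> vfields A \<Longrightarrow> Y \<in> vfields A \<Longrightarrow> T (vadd X Y) = T X + T Y"
    and scale: "\<And>f X. smooth_fun A f \<Longrightarrow> X \<in> vfields A \<Longrightarrow> T (vscale f X) = f p *\<^sub>R T X"
    and frame0: "\<And>X a. X \<in> vfields A \<Longrightarrow> agree_near A c p X (frame \<Gamma> c a) \<Longrightarrow> T X = (0 :: 'b::real_vector)"
  shows "T X = 0"
proof -
  obtain f W where f: "cutoff c (edom A c) f" "jet_open A W" "p \<in> W" "W \<subseteq> edom A c"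
    "\<And>q. q \<in> W \<Longrightarrow> f q = 1"
    using exists_cutoff[OF c p p jet_open_edom[OF c]] by blast
  define E where "E a = vextend c f (frame \<Gamma> c a)" for a
  define F where "F a q = f q * coframe \<Gamma> c q (X c q) a" for a q
  have E: "E a \<in> vfields A" for a
    unfolding E_def by (rule vextend_in_vfields[OF c f(1) smooth_frame[OF c]])
  have F: "smooth_fun A (F a)" for a
    unfolding F_def by (rule smooth_fun_extend[OF c f(1) smooth_coframe[OF c vfields_smooth[OF X c]]])
  have "agree_near A c p (E a) (frame \<Gamma> c a)" for a
    unfolding agree_near_def E_def
    using f(2-5) by (intro exI[of _ W]) (auto simp: vextend_chart[OF c])
  then have TE: "T (E a) = 0" for a using frame0[OF E] by blast
  have sum0: "T (\<lambda>c q. \<Sum>a\<in>N. F a q *\<^sub>R E a c q) = 0" if "finite N" for N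
    using that
  proof (induction N rule: finite_induct)
    case empty
    have "T (vscale (\<lambda>_. 0) X) = 0" using scale[OF _ X, of "\<lambda>_. 0"] by (simp add: smooth_fun_def)
    then show ?case by (simp add: vscale_def)
  next
    case (insert a N)
    have "T (vadd (vscale (F a) (E a)) (\<lambda>c q. \<Sum>a\<in>N. F a q *\<^sub>R E a c q)) = 0"
      using insert.IH add[OF vscale_in_vfields[OF F E] vsum_in_vfields[OF insert.hyps(1) F E]]
        scale[OF F E] TE by simp
    then show ?case using insert.hyps by (simp add: vadd_def vscale_def)
  qed
  \<comment> \<open>One factor \<open>f\<close> comes from the coefficient and one from the extended frame field.\<close>
  have "vscale (\<lambda>q. f q * f q) X = (\<lambda>c q. \<Sum>a\<in>UNIV. F a q *\<^sub>R E a c q)"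
  proof (intro ext)
    fix c' q
    show "vscale (\<lambda>q. f q * f q) X c' q = (\<Sum>a\<in>UNIV. F a q *\<^sub>R E a c' q)"
    proof (cases "c' \<in> echarts A \<and> q \<in> edom A c' \<and> f q \<noteq> 0")
      case True
      then have q: "q \<in> edom A c" and c': "c' \<in> echarts A" "q \<in> edom A c'"
        using cutoffD(3)[OF f(1)] by auto
      note lin = linear_dtrans[OF c c'(1) q c'(2)]
      have "X c' q = dtrans A c c' q (\<Sum>a\<in>UNIV. coframe \<Gamma> c q (X c q) a *\<^sub>R frame \<Gamma> c a q)"
        unfolding frame_expansion by (rule vfields_trans[OF X c c'(1) q c'(2)])
      also have "\<dots> = (\<Sum>a\<in>UNIV. coframe \<Gamma> c q (X c q) a *\<^sub>R dtrans A c c' q (frame \<Gamma> c a q))"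
        by (simp only: linear_sum[OF lin] linear_scale[OF lin])
      finally show ?thesis
        using q c' by (simp add: vscale_def F_def E_def vextend_def scaleR_sum_right mult_ac)
    next
      case False
      then consider "f q = 0" | "\<not> (c' \<in> echarts A \<and> q \<in> edom A c')" by blast
      then show ?thesis
        by cases (simp_all add: vscale_def F_def vfields_zero[OF X] vfields_zero[OF E])
    qed
  qed
  then have "T (vscale (\<lambda>q. f q * f q) X) = 0" using sum0[OF finite, of UNIV] by simp
  moreover have "smooth_fun A (\<lambda>q. f q * f q)" using cutoffD(1)[OF f(1)] by (rule smooth_fun_mult) (rule cutoffD(1)[OF f(1)])
  ultimately show ?thesis using scale[OF _ X] f(3,5) by simp
qed

lemma Gamma_linear_connection_block_proj:
  assumes "\<Gamma>_linear_connection A \<Gamma> D" "adapted_block B" "X \<in> vfields A" "Y \<in> vfields A"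
  shows "D X (block_proj B \<Gamma> Y) = block_proj B \<Gamma> (D X Y)"
  using assms unfolding \<Gamma>_linear_connection_def adapted_block_def adapted_projections by blast

text \<open>A projection does not change a field that extends a member of its own block of the frame, so
  the covariant derivative of such a field lies in the same block.\<close>

lemma local_conn_block:
  assumes D: "\<Gamma>_linear_connection A \<Gamma> D" and c: "c \<in> echarts A" and p: "p \<in> edom A c"
    and B: "adapted_block B" "b \<in> B" "e \<notin> B"
  shows "coframe \<Gamma> c p (local_conn A D c (frame \<Gamma> c a) (frame \<Gamma> c b) p) e = 0"
proof -
  have lin: "linear_connection A D" using D by (simp add: \<Gamma>_linear_connection_def)
  obtain X where X: "X \<in> vfields A" "agree_near A c p X (frame \<Gamma> c a)"
    using exists_agree_near[OF c p smooth_frame[OF c]] by blast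
  obtain Y where Y: "Y \<in> vfields A" "agree_near A c p Y (frame \<Gamma> c b)"
    using exists_agree_near[OF c p smooth_frame[OF c]] by blast
  have hY: "block_proj B \<Gamma> Y \<in> vfields A" by (rule block_proj_in_vfields[OF Y(1) B(1)])
  have "agree_near A c p (block_proj B \<Gamma> Y) (frame \<Gamma> c b)"
    using Y(2) block_proj_frame[OF _ B(2)] unfolding agree_near_def by metis
  then have "local_conn A D c (frame \<Gamma> c a) (frame \<Gamma> c b) p = D X (block_proj B \<Gamma> Y) c p"
    by (rule local_conn_eq[OF lin c p X(1) hY X(2)])
  also have "\<dots> = block_proj B \<Gamma> (D X Y) c p"
    by (simp only: Gamma_linear_connection_block_proj[OF D B(1) X(1) Y(1)])
  finally show ?thesis using B(3) by (simp add: block_proj_def coframe_combination)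
qed

lemma eq_block_combination_iff:
  fixes B :: "'n direction set"
  assumes "\<And>e. e \<notin> B \<Longrightarrow> coframe \<Gamma> c p w e = 0"
  shows "w = (\<Sum>a\<in>B. r a *\<^sub>R frame \<Gamma> c a p) \<longleftrightarrow> (\<forall>a\<in>B. r a = coframe \<Gamma> c p w a)"
proof
  assume "w = (\<Sum>a\<in>B. r a *\<^sub>R frame \<Gamma> c a p)"
  then show "\<forall>a\<in>B. r a = coframe \<Gamma> c p w a" by (simp add: coframe_combination)
next
  assume r: "\<forall>a\<in>B. r a = coframe \<Gamma> c p w a"
  have "w = (\<Sum>a\<in>B. coframe \<Gamma> c p w a *\<^sub>R frame \<Gamma> c a p)"
    using frame_expansion[of \<Gamma> c p w] assms by (subst sum.mono_neutral_left[of UNIV]) auto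
  then show "w = (\<Sum>a\<in>B. r a *\<^sub>R frame \<Gamma> c a p)" using r by simp
qed

text \<open>The indices \<open>e\<close>, \<open>b\<close>, \<open>a\<close> are those of the coefficient, of the differentiated field and of the
  direction. The value \<open>0\<close> off the chart domain is the one required of adapted components.\<close>

definition conn_coeff ::
  "('m, 'n) conn \<Rightarrow> ('m, 'n) echart \<Rightarrow> 'n direction \<Rightarrow> 'n direction \<Rightarrow> 'n direction \<Rightarrow> 'm jet \<Rightarrow> real" where
  "conn_coeff D c e b a p = (if p \<in> edom A c
     then coframe \<Gamma> c p (local_conn A D c (frame \<Gamma> c a) (frame \<Gamma> c b) p) e else 0)"

definition conn_components :: "('m, 'n) conn \<Rightarrow> ('m, 'n) echart \<Rightarrow> ('m, 'n) components" where
  "conn_components D c = (let t = Inl (); x = (\<lambda>i. Inr (Inl i)); y = (\<lambda>i. Inr (Inr i)); \<gamma> = conn_coeff D c in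
     Components
       (\<gamma> t t t) (\<lambda>k i. \<gamma> (x k) (x i) t) (\<lambda>k i. \<gamma> (y k) (y i) t)
       (\<lambda>j. \<gamma> t t (x j)) (\<lambda>k i j. \<gamma> (x k) (x i) (x j)) (\<lambda>k i j. \<gamma> (y k) (y i) (x j))
       (\<lambda>j. \<gamma> t t (y j)) (\<lambda>k i j. \<gamma> (x k) (x i) (y j)) (\<lambda>k i j. \<gamma> (y k) (y i) (y j)))"

lemma local_conn_expansion_iff:
  assumes D: "\<Gamma>_linear_connection A \<Gamma> D" and c: "c \<in> echarts A" and p: "p \<in> edom A c"
  shows "local_conn A D c (frame \<Gamma> c a) (\<delta>t \<Gamma> c) p = r0 *\<^sub>R \<delta>t \<Gamma> c p \<longleftrightarrow>
      r0 = conn_coeff D c (Inl ()) (Inl ()) a p"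
    and "local_conn A D c (frame \<Gamma> c a) (\<delta>x \<Gamma> c i) p = (\<Sum>k\<in>UNIV. r k *\<^sub>R \<delta>x \<Gamma> c k p) \<longleftrightarrow>
      (\<forall>k. r k = conn_coeff D c (Inr (Inl k)) (Inr (Inl i)) a p)"
    and "local_conn A D c (frame \<Gamma> c a) (dely i) p = (\<Sum>k\<in>UNIV. r k *\<^sub>R dely k p) \<longleftrightarrow>
      (\<forall>k. r k = conn_coeff D c (Inr (Inr k)) (Inr (Inr i)) a p)"
proof -
  have block: "local_conn A D c (frame \<Gamma> c a) (frame \<Gamma> c b) p = (\<Sum>e\<in>B. r e *\<^sub>R frame \<Gamma> c e p) \<longleftrightarrow>
      (\<forall>e\<in>B. r e = conn_coeff D c e b a p)" if "adapted_block B" "b \<in> B" for B b r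
    using eq_block_combination_iff[OF local_conn_block[OF D c p that]] p by (simp add: conn_coeff_def)
  have dirs: "adapted_block time_dir" "adapted_block base_dirs" "adapted_block fibre_dirs"
    by (simp_all add: adapted_block_def)
  show "local_conn A D c (frame \<Gamma> c a) (\<delta>t \<Gamma> c) p = r0 *\<^sub>R \<delta>t \<Gamma> c p \<longleftrightarrow>
      r0 = conn_coeff D c (Inl ()) (Inl ()) a p"
    using block[OF dirs(1), of "Inl ()" "\<lambda>_. r0"] by (simp add: time_dir_def)
  have "inj (\<lambda>i::'n. Inr (Inl i) :: 'n direction)" "inj (\<lambda>i::'n. Inr (Inr i) :: 'n direction)"
    by (auto intro: injI)
  then show "local_conn A D c (frame \<Gamma> c a) (\<delta>x \<Gamma> c i) p = (\<Sum>k\<in>UNIV. r k *\<^sub>R \<delta>x \<Gamma> c k p) \<longleftrightarrow>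
      (\<forall>k. r k = conn_coeff D c (Inr (Inl k)) (Inr (Inl i)) a p)"
    "local_conn A D c (frame \<Gamma> c a) (dely i) p = (\<Sum>k\<in>UNIV. r k *\<^sub>R dely k p) \<longleftrightarrow>
      (\<forall>k. r k = conn_coeff D c (Inr (Inr k)) (Inr (Inr i)) a p)"
    using block[OF dirs(2), of "Inr (Inl i)" "\<lambda>e. r (projl (projr e))"]
      block[OF dirs(3), of "Inr (Inr i)" "\<lambda>e. r (projr (projr e))"]
    by (simp_all add: base_dirs_def fibre_dirs_def sum.reindex)
qed

lemma adapted_components_iff:
  assumes D: "\<Gamma>_linear_connection A \<Gamma> D" and c: "c \<in> echarts A"
  shows "adapted_components A \<Gamma> D c K \<longleftrightarrow> K = conn_components D c"
proof -
  note iffs = local_conn_expansion_iff[OF D c]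
  note iff = iffs[where a="Inl ()", unfolded frame_simps] iffs[where a="Inr (Inl j)" for j, unfolded frame_simps]
    iffs[where a="Inr (Inr j)" for j, unfolded frame_simps]
  show ?thesis
  proof
    assume K: "adapted_components A \<Gamma> D c K"
    let ?t = "Inl ()" and ?x = "\<lambda>i. Inr (Inl i)" and ?y = "\<lambda>i. Inr (Inr i)" and ?\<gamma> = "conn_coeff D c"
    have "Gb K p = ?\<gamma> ?t ?t ?t p \<and> (\<forall>k i. G K k i p = ?\<gamma> (?x k) (?x i) ?t p)
      \<and> (\<forall>k i. Gv K k i p = ?\<gamma> (?y k) (?y i) ?t p)
      \<and> (\<forall>j. Lb K j p = ?\<gamma> ?t ?t (?x j) p) \<and> (\<forall>k i j. L K k i j p = ?\<gamma> (?x k) (?x i) (?x j) p)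
      \<and> (\<forall>k i j. Lv K k i j p = ?\<gamma> (?y k) (?y i) (?x j) p)
      \<and> (\<forall>j. Cb K j p = ?\<gamma> ?t ?t (?y j) p) \<and> (\<forall>k i j. C K k i j p = ?\<gamma> (?x k) (?x i) (?y j) p)
      \<and> (\<forall>k i j. Cv K k i j p = ?\<gamma> (?y k) (?y i) (?y j) p)" for p
    proof (cases "p \<in> edom A c")
      case True
      show ?thesis
        using K[unfolded adapted_components_def, THEN conjunct2, THEN bspec, OF True]
        by (simp add: iff[OF True])
    next
      case False
      then show ?thesis
        using K unfolding adapted_components_def all_components_def by (simp add: conn_coeff_def)
    qed
    then show "K = conn_components D c"
      by (intro components.expand) (simp add: conn_components_def Let_def fun_eq_iff)
  next
    assume [simp]: "K = conn_components D c"
    show "adapted_components A \<Gamma> D c K"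
      unfolding adapted_components_def all_components_def
      by (simp add: conn_components_def Let_def iff) (simp add: conn_coeff_def)
  qed
qed

lemma smooth_conn_coeff:
  assumes D: "\<Gamma>_linear_connection A \<Gamma> D" and c: "c \<in> echarts A"
  shows "smooth_local A c (conn_coeff D c e b a)"
proof (rule smooth_local_cong[OF c])
  have "linear_connection A D" using D by (simp add: \<Gamma>_linear_connection_def)
  then show "smooth_local A c (\<lambda>p. coframe \<Gamma> c p (local_conn A D c (frame \<Gamma> c a) (frame \<Gamma> c b) p) e)"
    by (intro smooth_coframe smooth_local_conn smooth_frame c)
qed (simp add: conn_coeff_def)

lemma smooth_conn_components:
  assumes "\<Gamma>_linear_connection A \<Gamma> D" "c \<in> echarts A"
  shows "smooth_components A c (conn_components D c)"
  unfolding smooth_components_def all_components_def conn_components_def Let_def components.sel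
  using smooth_conn_coeff[OF assms] by blast

lemma local_conn_frame_eq:
  assumes "adapted_components A \<Gamma> D c K" "adapted_components A \<Gamma> D' c K" "p \<in> edom A c"
  shows "local_conn A D c (frame \<Gamma> c a) (frame \<Gamma> c b) p = local_conn A D' c (frame \<Gamma> c a) (frame \<Gamma> c b) p"
  using assms unfolding adapted_components_def
  by (cases a; cases "projr a"; cases b; cases "projr b") simp_all

text \<open>The derivative terms of the Leibniz rule cancel in the difference of two connections. It is
  therefore linear over the smooth functions in both arguments, and its vanishing can be tested on
  extensions of the frame, first for the direction and then for the differentiated field.\<close>

lemma connection_eqI:
  assumes D: "linear_connection A D" "linear_connection A D'"
    and eq: "\<And>c p a b. c \<in> echarts A \<Longrightarrow> p \<in> edom A c \<Longrightarrow>
      local_conn A D c (frame \<Gamma> c a) (frame \<Gamma> c b) p = local_conn A D' c (frame \<Gamma> c a) (frame \<Gamma> c b) p"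
    and XY: "X \<in> vfields A" "Y \<in> vfields A"
  shows "D X Y = D' X Y"
proof (intro ext)
  fix c p
  show "D X Y c p = D' X Y c p"
  proof (cases "c \<in> echarts A \<and> p \<in> edom A c")
    case True
    then have c: "c \<in> echarts A" and p: "p \<in> edom A c" by auto
    let ?T = "\<lambda>X Y. D X Y c p - D' X Y c p"
    have "?T X Y = 0"
    proof (rule tensorial_eq_0[OF c p XY(1), of "\<lambda>X. ?T X Y"])
      fix X a assume X: "X \<in> vfields A" "agree_near A c p X (frame \<Gamma> c a)"
      show "?T X Y = 0"
      proof (rule tensorial_eq_0[OF c p XY(2), of "\<lambda>Y. ?T X Y"])
        fix Y b assume Y: "Y \<in> vfields A" "agree_near A c p Y (frame \<Gamma> c b)"
        show "?T X Y = 0"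
          using eq[OF c p] local_conn_eq[OF D(1) c p X(1) Y(1) X(2) Y(2)]
            local_conn_eq[OF D(2) c p X(1) Y(1) X(2) Y(2)] by simp
      qed (simp_all add: X linear_connectionD(4,5)[OF D(1)] linear_connectionD(4,5)[OF D(2)],
          simp_all add: vadd_def algebra_simps)
    qed (simp_all add: XY linear_connectionD(2,3)[OF D(1)] linear_connectionD(2,3)[OF D(2)],
        simp_all add: vadd_def vscale_def algebra_simps)
    then show ?thesis by simp
  next
    case False
    then show ?thesis
      using vfields_zero[OF linear_connectionD(1)[OF D(1) XY], of c p]
        vfields_zero[OF linear_connectionD(1)[OF D(2) XY], of c p] by simp
  qed
qed

end

theorem proposition2p6:
  fixes M :: "'m topology"
    and A :: "('m, 'n::finite) mchart set"
    and \<Gamma> :: "('m, 'n) nlconn"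
    and D :: "('m, 'n) conn"
  assumes "smooth_manifold M A"
    and "nonlinear_connection A \<Gamma>"
    and "\<Gamma>_linear_connection A \<Gamma> D"
  shows "(\<forall>c\<in>echarts A. (\<exists>!K. adapted_components A \<Gamma> D c K) \<and>
            (\<forall>K. adapted_components A \<Gamma> D c K \<longrightarrow> smooth_components A c K)) \<and>
         (\<forall>D' K. \<Gamma>_linear_connection A \<Gamma> D' \<and>
            (\<forall>c\<in>echarts A. adapted_components A \<Gamma> D c (K c) \<and> adapted_components A \<Gamma> D' c (K c)) \<longrightarrow>
            (\<forall>X\<in>vfields A. \<forall>Y\<in>vfields A. D' X Y = D X Y))"
proof -
  interpret jet_nonlinear_connection M A \<Gamma>
    by unfold_locales (fact assms)+
  show ?thesis
  proof (intro conjI ballI allI impI)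
    fix c assume c: "c \<in> echarts A"
    show "\<exists>!K. adapted_components A \<Gamma> D c K"
      by (simp add: adapted_components_iff[OF assms(3) c])
    show "smooth_components A c K" if "adapted_components A \<Gamma> D c K" for K
      using that smooth_conn_components[OF assms(3) c] adapted_components_iff[OF assms(3) c] by simp
  next
    fix D' K X Y
    assume *: "\<Gamma>_linear_connection A \<Gamma> D' \<and>
      (\<forall>c\<in>echarts A. adapted_components A \<Gamma> D c (K c) \<and> adapted_components A \<Gamma> D' c (K c))"
      and XY: "X \<in> vfields A" "Y \<in> vfields A"
    show "D' X Y = D X Y"
    proof (rule connection_eqI[OF _ _ _ XY])
      show "linear_connection A D'" "linear_connection A D"
        using * assms(3) by (simp_all add: \<Gamma>_linear_connection_def)
      show "local_conn A D' c (frame \<Gamma> c a) (frame \<Gamma> c b) p = local_conn A D c (frame \<Gamma> c a) (frame \<Gamma> c b) p"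
        if "c \<in> echarts A" "p \<in> edom A c" for c p a b
        by (rule local_conn_frame_eq[of D' c "K c" D p]) (use * that in blast)+
    qed
  qed
qed

end
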